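(* The Banach-Mazur distance between the real Banach spaces $\ell_\infty$ and $L_\infty[0,1]$ (with respect to Lebesgue measure) satisfies $$d_{\rm BM}\big(\ell_\infty, L_\infty[0,1]\big)\ \le\ (3+\sqrt{2})^2\ <\ 19.49.$$
   Context: For Banach spaces $X,Y$, the Banach-Mazur distance $d_{\rm BM}(X,Y)$ is the infimum of $\|T\|\cdot\|T^{-1}\|$ over all linear isomorphisms (linear homeomorphisms) $T:X\to Y$ onto $Y$, with the convention that it is $+\infty$ if no such isomorphism exists. $L_\infty[0,1]$ carries the essential supremum norm and $\ell_\infty$ the supremum norm. *)

theory Defs
  imports "HOL-Analysis.Analysis" "HOL-Probability.Essential_Supremum"
begin

text \<open>
  As \<^typ>\<open>nat\<close> carries the discrete topology, bounded continuous functions on it are exactly the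
  bounded sequences.
\<close>

type_synonym linfty = "nat \<Rightarrow>\<^sub>C real"

lemma linfty_range: "range (apply_bcontfun :: linfty \<Rightarrow> nat \<Rightarrow> real) = {a. bounded (range a)}"
  using type_definition.Rep_range[OF type_definition_bcontfun, where ?'a1 = nat and ?'b1 = real]
  by (auto simp: bcontfun_def)

lemma linfty_norm: "norm (a :: linfty) = (SUP n. \<bar>apply_bcontfun a n\<bar>)"
  by (simp add: norm_bcontfun_def dist_bcontfun.rep_eq zero_bcontfun.rep_eq dist_real_def)

abbreviation leb01 :: "real measure" where
  "leb01 \<equiv> lebesgue_on {0..1}"

definition ess_bounded :: "(real \<Rightarrow> real) \<Rightarrow> bool" where
  "ess_bounded f \<longleftrightarrow> f \<in> borel_measurable leb01 \<and> esssup leb01 (\<lambda>x. ereal \<bar>f x\<bar>) < \<infinity>"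

definition ess_norm :: "(real \<Rightarrow> real) \<Rightarrow> real" where
  "ess_norm f = real_of_ereal (esssup leb01 (\<lambda>x. ereal \<bar>f x\<bar>))"

lemma emeasure_leb01_space: "emeasure leb01 (space leb01) \<noteq> 0"
  by (simp add: emeasure_restrict_space)

lemma esssup_leb01_nonneg:
  assumes "f \<in> borel_measurable leb01"
  shows "0 \<le> esssup leb01 (\<lambda>x. ereal \<bar>f x\<bar>)"
proof -
  have "esssup leb01 (\<lambda>x. 0 :: ereal) \<le> esssup leb01 (\<lambda>x. ereal \<bar>f x\<bar>)"
    by (rule esssup_mono) auto
  then show ?thesis
    using esssup_const[OF emeasure_leb01_space, of "0::ereal"] by simp
qed

lemma ess_bounded_measurable: "ess_bounded f \<Longrightarrow> f \<in> borel_measurable leb01"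
  by (simp add: ess_bounded_def)

lemma ereal_ess_norm:
  assumes "ess_bounded f"
  shows "ereal (ess_norm f) = esssup leb01 (\<lambda>x. ereal \<bar>f x\<bar>)"
  using assms esssup_leb01_nonneg[of f]
  by (cases "esssup leb01 (\<lambda>x. ereal \<bar>f x\<bar>)") (auto simp: ess_bounded_def ess_norm_def)

lemma ess_norm_nonneg: "ess_bounded f \<Longrightarrow> 0 \<le> ess_norm f"
  using esssup_leb01_nonneg[of f] ereal_ess_norm[of f] ess_bounded_measurable[of f]
  by (metis ereal_less_eq(5))

lemma AE_ess_norm:
  assumes "ess_bounded f"
  shows "AE x in leb01. \<bar>f x\<bar> \<le> ess_norm f"
  using esssup_AE[of "\<lambda>x. ereal \<bar>f x\<bar>" leb01] unfolding ereal_ess_norm[OF assms, symmetric] by simp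

lemma ess_boundedI:
  assumes [measurable]: "f \<in> borel_measurable leb01" and "AE x in leb01. \<bar>f x\<bar> \<le> c"
  shows "ess_bounded f" "ess_norm f \<le> c"
proof -
  have le: "esssup leb01 (\<lambda>x. ereal \<bar>f x\<bar>) \<le> ereal c"
    using assms(2) by (intro esssup_I) auto
  then show "ess_bounded f"
    using assms(1) by (auto simp: ess_bounded_def intro: le_less_trans)
  then show "ess_norm f \<le> c"
    using le ereal_ess_norm by (metis ereal_less_eq(3))
qed

lemma ess_bounded_zero: "ess_bounded (\<lambda>x. 0)"
  by (rule ess_boundedI[where c = 0]) auto

lemma ess_bounded_add:
  assumes "ess_bounded f" "ess_bounded g"
  shows "ess_bounded (\<lambda>x. f x + g x)" "ess_norm (\<lambda>x. f x + g x) \<le> ess_norm f + ess_norm g"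
proof -
  have [measurable]: "f \<in> borel_measurable leb01" "g \<in> borel_measurable leb01"
    using assms by (auto intro: ess_bounded_measurable)
  have "AE x in leb01. \<bar>f x + g x\<bar> \<le> ess_norm f + ess_norm g"
    using AE_ess_norm[OF assms(1)] AE_ess_norm[OF assms(2)] by eventually_elim linarith
  then show "ess_bounded (\<lambda>x. f x + g x)" "ess_norm (\<lambda>x. f x + g x) \<le> ess_norm f + ess_norm g"
    by (auto intro!: ess_boundedI(2) intro: ess_boundedI(1))
qed

lemma ess_bounded_scale:
  assumes "ess_bounded f"
  shows "ess_bounded (\<lambda>x. r * f x)" "ess_norm (\<lambda>x. r * f x) \<le> \<bar>r\<bar> * ess_norm f"
proof -
  have [measurable]: "f \<in> borel_measurable leb01"
    using assms by (auto intro: ess_bounded_measurable)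
  have "AE x in leb01. \<bar>r * f x\<bar> \<le> \<bar>r\<bar> * ess_norm f"
    using AE_ess_norm[OF assms(1)] by eventually_elim (simp add: abs_mult mult_left_mono)
  then show "ess_bounded (\<lambda>x. r * f x)" "ess_norm (\<lambda>x. r * f x) \<le> \<bar>r\<bar> * ess_norm f"
    by (auto intro!: ess_boundedI(2) intro: ess_boundedI(1))
qed

lemma ess_bounded_uminus: "ess_bounded f \<Longrightarrow> ess_bounded (\<lambda>x. - f x)"
  using ess_bounded_scale(1)[of f "-1"] by simp

lemma ess_bounded_diff: "ess_bounded f \<Longrightarrow> ess_bounded g \<Longrightarrow> ess_bounded (\<lambda>x. f x - g x)"
  using ess_bounded_add(1)[of f "\<lambda>x. - g x"] ess_bounded_uminus[of g] by simp

lemma ess_norm_scale: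
  assumes "ess_bounded f"
  shows "ess_norm (\<lambda>x. r * f x) = \<bar>r\<bar> * ess_norm f"
proof (cases "r = 0")
  case True
  then show ?thesis
    using ess_boundedI(2)[of "\<lambda>x. 0" 0] ess_norm_nonneg[OF ess_bounded_zero] by simp
next
  case False
  have "ess_norm (\<lambda>x. inverse r * (r * f x)) \<le> \<bar>inverse r\<bar> * ess_norm (\<lambda>x. r * f x)"
    by (intro ess_bounded_scale assms)
  then have "\<bar>r\<bar> * ess_norm f \<le> ess_norm (\<lambda>x. r * f x)"
    using False by (simp add: field_simps)
  then show ?thesis
    using ess_bounded_scale(2)[OF assms, of r] by simp
qed

quotient_type Linfty01 = "real \<Rightarrow> real" / partial:
  "\<lambda>f g. ess_bounded f \<and> ess_bounded g \<and> (AE x in leb01. f x = g x)"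
proof (rule part_equivpI)
  show "\<exists>f. ess_bounded f \<and> ess_bounded f \<and> (AE x in leb01. f x = f x)"
    using ess_bounded_zero by auto
  show "symp (\<lambda>f g. ess_bounded f \<and> ess_bounded g \<and> (AE x in leb01. f x = g x))"
    by (auto simp: symp_def elim: eventually_mono)
  show "transp (\<lambda>f g. ess_bounded f \<and> ess_bounded g \<and> (AE x in leb01. f x = g x))"
    by (rule transpI) (auto elim: eventually_elim2)
qed

instantiation Linfty01 :: real_vector
begin

lift_definition zero_Linfty01 :: Linfty01 is "\<lambda>x. 0"
  by (simp add: ess_bounded_zero)

lift_definition plus_Linfty01 :: "Linfty01 \<Rightarrow> Linfty01 \<Rightarrow> Linfty01" is "\<lambda>f g x. f x + g x"
  by (auto intro: ess_bounded_add elim: eventually_elim2)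

lift_definition uminus_Linfty01 :: "Linfty01 \<Rightarrow> Linfty01" is "\<lambda>f x. - f x"
  by (auto intro: ess_bounded_uminus elim: eventually_mono)

lift_definition minus_Linfty01 :: "Linfty01 \<Rightarrow> Linfty01 \<Rightarrow> Linfty01" is "\<lambda>f g x. f x - g x"
  by (auto intro: ess_bounded_diff elim: eventually_elim2)

lift_definition scaleR_Linfty01 :: "real \<Rightarrow> Linfty01 \<Rightarrow> Linfty01" is "\<lambda>r f x. r * f x"
  by (auto intro: ess_bounded_scale elim: eventually_mono)

instance
proof
  fix a b c :: Linfty01 and r s :: real
  show "a + b + c = a + (b + c)"
    by transfer (auto intro!: ess_bounded_add simp: add.assoc)
  show "a + b = b + a"
    by transfer (auto intro!: ess_bounded_add simp: add.commute)
  show "0 + a = a"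
    by transfer auto
  show "- a + a = 0"
    by transfer (auto simp: ess_bounded_zero)
  show "a - b = a + - b"
    by transfer (auto intro: ess_bounded_diff)
  show "r *\<^sub>R (a + b) = r *\<^sub>R a + r *\<^sub>R b"
    by transfer (auto intro!: ess_bounded_add ess_bounded_scale simp: distrib_left)
  show "(r + s) *\<^sub>R a = r *\<^sub>R a + s *\<^sub>R a"
    by transfer (auto intro!: ess_bounded_add ess_bounded_scale simp: distrib_right)
  show "r *\<^sub>R s *\<^sub>R a = (r * s) *\<^sub>R a"
    by transfer (auto intro!: ess_bounded_scale simp: mult.assoc)
  show "1 *\<^sub>R a = a"
    by transfer auto
qed

end

instantiation Linfty01 :: real_normed_vector
begin

lift_definition norm_Linfty01 :: "Linfty01 \<Rightarrow> real" is ess_norm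
  unfolding ess_norm_def
  by (rule arg_cong[where f = real_of_ereal], rule esssup_AE_cong)
    (auto simp: ess_bounded_def)

definition dist_Linfty01 :: "Linfty01 \<Rightarrow> Linfty01 \<Rightarrow> real" where
  "dist_Linfty01 f g = norm (f - g)"

definition sgn_Linfty01 :: "Linfty01 \<Rightarrow> Linfty01" where
  "sgn_Linfty01 f = f /\<^sub>R norm f"

definition uniformity_Linfty01 :: "(Linfty01 \<times> Linfty01) filter" where
  "uniformity_Linfty01 = (INF e\<in>{0 <..}. principal {(x, y). dist x y < e})"

definition open_Linfty01 :: "Linfty01 set \<Rightarrow> bool" where
  "open_Linfty01 S = (\<forall>x\<in>S. \<forall>\<^sub>F (x', y) in uniformity. x' = x \<longrightarrow> y \<in> S)"

instance
proof
  fix a b :: Linfty01 and r :: real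
  show "dist a b = norm (a - b)"
    by (rule dist_Linfty01_def)
  show "sgn a = a /\<^sub>R norm a"
    by (rule sgn_Linfty01_def)
  show "uniformity = (INF e\<in>{0 <..}. principal {(x::Linfty01, y). dist x y < e})"
    by (rule uniformity_Linfty01_def)
  show "open U = (\<forall>x\<in>U. \<forall>\<^sub>F (x', y) in uniformity. x' = x \<longrightarrow> y \<in> U)" for U :: "Linfty01 set"
    by (rule open_Linfty01_def)
  show "norm (a + b) \<le> norm a + norm b"
    by transfer (auto intro: ess_bounded_add)
  show "norm (r *\<^sub>R a) = \<bar>r\<bar> * norm a"
    by transfer (auto intro: ess_norm_scale)
  show "norm a = 0 \<longleftrightarrow> a = 0"
  proof transfer
    fix f assume "ess_bounded f \<and> ess_bounded f \<and> (AE x in leb01. f x = f x)"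
    then have f: "ess_bounded f" by simp
    have "AE x in leb01. f x = 0" if "ess_norm f = 0"
      using AE_ess_norm[OF f] that by simp
    moreover have "ess_norm f = 0" if "AE x in leb01. f x = 0"
      using ess_boundedI(2)[OF ess_bounded_measurable[OF f], of 0] that ess_norm_nonneg[OF f]
      by simp
    ultimately show "ess_norm f = 0 \<longleftrightarrow>
        ess_bounded f \<and> ess_bounded (\<lambda>x. 0) \<and> (AE x in leb01. f x = 0)"
      using f ess_bounded_zero by blast
  qed
qed

end

instance Linfty01 :: banach
proof
  fix X :: "nat \<Rightarrow> Linfty01"
  assume X: "Cauchy X"
  have "\<exists>f. \<forall>n. ess_bounded (f n) \<and> abs_Linfty01 (f n) = X n"
  proof (intro choice allI)
    fix n
    show "\<exists>f. ess_bounded f \<and> abs_Linfty01 f = X n"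
      by (induction "X n" rule: Linfty01.abs_induct) auto
  qed
  then obtain f where f: "\<And>n. ess_bounded (f n)" and Xf: "\<And>n. X n = abs_Linfty01 (f n)"
    by metis
  have diff: "norm (X n - abs_Linfty01 g) = ess_norm (\<lambda>x. f n x - g x)" if "ess_bounded g" for n g
    using f[of n] that
    by (simp add: Xf minus_Linfty01.abs_eq norm_Linfty01.abs_eq ess_bounded_diff)
  have [measurable]: "\<And>n. f n \<in> borel_measurable leb01"
    using f by (rule ess_bounded_measurable)
  define g where "g x = lim (\<lambda>n. f n x)" for x
  have g [measurable]: "g \<in> borel_measurable leb01"
    unfolding g_def by measurable
  have "AE x in leb01. \<forall>m n. \<bar>f m x - f n x\<bar> \<le> norm (X m - X n)"
    unfolding AE_all_countable
  proof (intro allI)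
    fix m n
    show "AE x in leb01. \<bar>f m x - f n x\<bar> \<le> norm (X m - X n)"
      unfolding Xf[of n] diff[OF f] by (intro AE_ess_norm ess_bounded_diff f)
  qed
  then have lim: "AE x in leb01. (\<forall>m n. \<bar>f m x - f n x\<bar> \<le> norm (X m - X n)) \<and>
      (\<lambda>n. f n x) \<longlonglongrightarrow> g x"
  proof eventually_elim
    case (elim x)
    have "Cauchy (\<lambda>n. f n x)"
      using X elim unfolding Cauchy_def dist_norm real_norm_def by (meson le_less_trans)
    then show ?case
      using elim by (simp add: g_def Cauchy_convergent_iff convergent_LIMSEQ_iff)
  qed
  have close: "AE x in leb01. \<bar>f m x - g x\<bar> \<le> e"
    if "\<And>n. n \<ge> N \<Longrightarrow> norm (X m - X n) \<le> e" for m N e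
    using lim
  proof eventually_elim
    case (elim x)
    have "(\<lambda>n. \<bar>f m x - f n x\<bar>) \<longlonglongrightarrow> \<bar>f m x - g x\<bar>"
      using elim by (auto intro!: tendsto_intros)
    moreover have "\<forall>n\<ge>N. \<bar>f m x - f n x\<bar> \<le> e"
      using elim that order_trans by blast
    ultimately show ?case
      by (blast intro: LIMSEQ_le_const2)
  qed
  have bound: "\<exists>N. \<forall>m\<ge>N. AE x in leb01. \<bar>f m x - g x\<bar> \<le> e" if "e > 0" for e
  proof -
    obtain N where "\<And>m n. m \<ge> N \<Longrightarrow> n \<ge> N \<Longrightarrow> norm (X m - X n) < e"
      using X \<open>e > 0\<close> unfolding Cauchy_def dist_norm by metis
    then show ?thesis
      using close[of N _ e] by (meson less_imp_le)
  qed
  obtain N where "AE x in leb01. \<bar>f N x - g x\<bar> \<le> 1"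
    using bound[of 1] by auto
  then have "AE x in leb01. \<bar>g x\<bar> \<le> ess_norm (f N) + 1"
    using AE_ess_norm[OF f[of N]] by eventually_elim linarith
  then have gb: "ess_bounded g"
    by (rule ess_boundedI(1)[OF g])
  have "X \<longlonglongrightarrow> abs_Linfty01 g"
  proof (rule LIMSEQ_I)
    fix r :: real assume "0 < r"
    then obtain N where N: "\<And>m. m \<ge> N \<Longrightarrow> AE x in leb01. \<bar>f m x - g x\<bar> \<le> r / 2"
      using bound[of "r/2"] by auto
    have "norm (X m - abs_Linfty01 g) \<le> r / 2" if "m \<ge> N" for m
      unfolding diff[OF gb] by (rule ess_boundedI(2)) (use N[OF that] in auto)
    then show "\<exists>no. \<forall>n\<ge>no. norm (X n - abs_Linfty01 g) < r"
      using \<open>0 < r\<close> by (intro exI[of _ N]) force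
  qed
  then show "convergent X"
    by (auto simp: convergent_def)
qed

text \<open>The infimum is taken in \<^typ>\<open>ereal\<close>, so it is \<open>\<infinity>\<close> if no isomorphism exists.\<close>

definition banach_mazur_dist :: "'a::real_normed_vector itself \<Rightarrow> 'b::real_normed_vector itself \<Rightarrow> ereal" where
  "banach_mazur_dist _ _ =
    (INF T \<in> {T :: 'a \<Rightarrow> 'b. bounded_linear T \<and> bij T \<and> bounded_linear (inv T)}.
      ereal (onorm T * onorm (inv T)))"

end

theory Submission
  imports Defs
begin

text \<open>
  Write \<open>X = \<ell>\<^sub>\<infinity>\<close> and \<open>Y = L\<^sub>\<infinity>[0,1]\<close>. Each space is isometric to the \<open>\<ell>\<^sub>\<infinity>\<close>-sum of countably many
  copies of itself, and each embeds into the other as the range of a norm-one projection: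
  \<open>X\<close> sits in \<open>Y\<close> as the functions constant on dyadic pieces, with averaging as the retraction;
  \<open>Y\<close> sits in \<open>X\<close> through the averages over the cells of all uniform grids, with a retraction obtained
  as a weak* generalised limit of step functions and the Radon-Nikodym theorem.

  Pelczynski's decomposition method then gives isomorphisms \<open>X \<rightarrow> Y \<oplus> X\<close> and \<open>Y \<rightarrow> X \<oplus> Y\<close> by
  shifting the complemented summand of \<open>x = (x\<^sub>0, x\<^sub>1, \<dots>)\<close> by one place. Estimating the composite
  \<open>X \<rightarrow> Y \<oplus> X \<rightarrow> Y\<close> as one map, rather than its two factors separately, and scaling the shifted
  summand by \<open>\<gamma> > 0\<close>, bounds it and its inverse by \<open>max (4 + \<gamma>) (2 + 1 / \<gamma>)\<close>; both terms equal
  \<open>3 + sqrt 2\<close> at \<open>\<gamma> = sqrt 2 - 1\<close>.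
\<close>

section \<open>Decomposition method for mutual contractive retracts\<close>

text \<open>The assumptions make x |-> (c n x)_n an isometry onto the bounded sequences in the space
  with the sup norm, so the space is its own countable sup-sum, without a separate type for the
  sum.\<close>

locale countable_sup_power =
  fixes c :: "nat \<Rightarrow> 'a::real_normed_vector \<Rightarrow> 'a"
  assumes linear_coord: "linear (c n)"
    and norm_coord: "norm (c n x) \<le> norm x"
    and norm_le: "(\<And>n. norm (c n x) \<le> K) \<Longrightarrow> norm x \<le> K"
    and coord_surj: "(\<And>n. norm (s n) \<le> K) \<Longrightarrow> \<exists>x. \<forall>n. c n x = s n"
begin

lemma coord_eqI: "x = y" if "\<And>n. c n x = c n y"
proof -
  have "norm (x - y) \<le> 0"
    by (rule norm_le) (simp add: linear_diff[OF linear_coord] that)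
  then show ?thesis by simp
qed

definition join :: "(nat \<Rightarrow> 'a) \<Rightarrow> 'a" where
  "join s = (SOME x. \<forall>n. c n x = s n)"

lemma coord_join:
  assumes "\<And>n. norm (s n) \<le> K"
  shows "c n (join s) = s n"
proof -
  have "\<forall>n. c n (join s) = s n"
    unfolding join_def by (rule someI_ex, rule coord_surj, rule assms)
  then show ?thesis by simp
qed

lemma norm_join_le:
  assumes "\<And>n. norm (s n) \<le> K"
  shows "norm (join s) \<le> K"
  by (rule norm_le) (simp add: coord_join[OF assms] assms)

lemmas coord_simps = linear_add[OF linear_coord] linear_diff[OF linear_coord]
  linear_scale[OF linear_coord]

end

text \<open>Such a \<open>g\<close> is isometric, since norm y = norm (p (g y)) \<le> norm (g y),
  and \<open>g o p\<close> is a norm-one projection onto its range.\<close>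

locale contractive_retract =
  fixes g :: "'b::real_normed_vector \<Rightarrow> 'a::real_normed_vector" and p :: "'a \<Rightarrow> 'b"
  assumes linear_embed: "linear g" and norm_embed: "norm (g y) \<le> norm y"
    and linear_retract: "linear p" and norm_retract: "norm (p x) \<le> norm x"
    and retract_embed: "p (g y) = y"
begin

text \<open>The projection onto the kernel of \<open>p\<close> along the range of \<open>g\<close>.
  The triangle inequality bounds it only by 2; this is the source of every constant 2 in the
  estimates below.\<close>

definition compl :: "'a \<Rightarrow> 'a" where
  "compl x = x - g (p x)"

lemma norm_embed_retract: "norm (g (p x)) \<le> norm x"
  using norm_embed norm_retract order_trans by blast

lemma norm_compl: "norm (compl x) \<le> 2 * norm x"
  unfolding compl_def using norm_triangle_ineq4[of x "g (p x)"] norm_embed_retract[of x] by linarith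

lemma linear_compl: "linear compl"
  by (rule linearI)
    (simp_all add: compl_def linear_add[OF linear_retract] linear_add[OF linear_embed]
      linear_scale[OF linear_retract] linear_scale[OF linear_embed] algebra_simps)

lemmas retract_simps = linear_add[OF linear_embed] linear_scale[OF linear_embed]
  linear_add[OF linear_retract] linear_scale[OF linear_retract]
  linear_add[OF linear_compl] linear_scale[OF linear_compl]

lemma retract_compl: "p (compl x) = 0"
  by (simp add: compl_def linear_diff[OF linear_retract] retract_embed)

lemma compl_embed: "compl (g y) = 0"
  by (simp add: compl_def retract_embed)

lemma compl_compl: "compl (compl x) = compl x"
  by (simp add: compl_def[of "compl x"] retract_compl linear_0[OF linear_embed])

lemma embed_retract_compl: "g (p x) + compl x = x" "compl x + g (p x) = x"
  by (simp_all add: compl_def)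

end

section \<open>Splitting off one copy of the retract by a weighted shift\<close>

locale power_retract = countable_sup_power c + contractive_retract g p
  for c :: "nat \<Rightarrow> 'a::real_normed_vector \<Rightarrow> 'a" and g :: "'b::real_normed_vector \<Rightarrow> 'a" and p
begin

abbreviation wt :: real where "wt \<equiv> sqrt 2 - 1"

lemma wt: "wt > 0" "wt * (sqrt 2 + 1) = 1" "(sqrt 2 + 1) * wt = 1"
proof -
  show "wt > 0" by simp
  show "wt * (sqrt 2 + 1) = 1" "(sqrt 2 + 1) * wt = 1" by (simp_all add: algebra_simps)
qed

text \<open>In each coordinate the complement part stays in place, while the \<open>g\<close>-part
  comes from the next coordinate, scaled by \<open>wt\<close>. Only \<open>p (c 0 x)\<close> is
  lost, so \<open>p (c 0 x)\<close> and \<open>rest x\<close> together determine x.\<close>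

definition rest_seq :: "'a \<Rightarrow> nat \<Rightarrow> 'a" where
  "rest_seq x n = wt *\<^sub>R g (p (c (Suc n) x)) + compl (c n x)"

definition rest :: "'a \<Rightarrow> 'a" where
  "rest x = join (rest_seq x)"

text \<open>The reverse shift: y fills the vacated \<open>g\<close>-part of coordinate 0, and the
  factor \<open>sqrt 2 + 1\<close> is the inverse of \<open>wt\<close>.\<close>

definition merge_seq :: "'b \<Rightarrow> 'a \<Rightarrow> nat \<Rightarrow> 'a" where
  "merge_seq y u n = (case n of 0 \<Rightarrow> g y + compl (c 0 u)
     | Suc m \<Rightarrow> (sqrt 2 + 1) *\<^sub>R g (p (c m u)) + compl (c (Suc m) u))"

definition merge :: "'b \<Rightarrow> 'a \<Rightarrow> 'a" where
  "merge y u = join (merge_seq y u)"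

lemma norm_embed_retract_coord: "norm (g (p (c n x))) \<le> norm x"
  using norm_embed_retract norm_coord order_trans by blast

lemma norm_compl_coord: "norm (compl (c n x)) \<le> 2 * norm x"
  using norm_compl[of "c n x"] norm_coord[of n x] by linarith

text \<open>The bound is \<open>wt + 2\<close>, which for this weight equals 1 /
  \<open>wt\<close>.\<close>

lemma norm_rest_seq: "norm (rest_seq x n) \<le> (sqrt 2 + 1) * norm x"
proof -
  have "norm (rest_seq x n) \<le> wt * norm (g (p (c (Suc n) x))) + norm (compl (c n x))"
    unfolding rest_seq_def using wt(1) by (intro norm_triangle_le) simp
  also have "\<dots> \<le> wt * norm x + 2 * norm x"
    using wt(1) by (intro add_mono mult_left_mono norm_embed_retract_coord norm_compl_coord) simp
  finally show ?thesis by (simp add: algebra_simps)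
qed

lemma norm_rest: "norm (rest x) \<le> (sqrt 2 + 1) * norm x"
  unfolding rest_def by (intro norm_join_le norm_rest_seq)

lemma coord_rest: "c n (rest x) = rest_seq x n"
  unfolding rest_def by (rule coord_join, rule norm_rest_seq)

text \<open>The hypotheses are unequal because y will be an output of \<open>rest\<close>, with
  bound \<open>wt + 2\<close>, and u an output of a retraction, with bound 1. Coordinate 0 then
  costs (\<open>wt\<close> + 2) + 2 and the others 1 / \<open>wt\<close> + 2, and the weight makes
  the two equal.\<close>

lemma norm_merge_seq:
  assumes "norm y \<le> (sqrt 2 + 1) * K" "norm u \<le> K"
  shows "norm (merge_seq y u n) \<le> (3 + sqrt 2) * K"
proof (cases n)
  case 0
  have "norm (merge_seq y u n) \<le> norm (g y) + norm (compl (c 0 u))"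
    by (simp add: merge_seq_def 0 norm_triangle_ineq)
  also have "\<dots> \<le> (sqrt 2 + 1) * K + 2 * K"
    using norm_embed[of y] norm_compl_coord[of 0 u] assms by linarith
  finally show ?thesis by (simp add: algebra_simps)
next
  case (Suc m)
  have "norm (merge_seq y u n) \<le> (sqrt 2 + 1) * norm (g (p (c m u))) + norm (compl (c (Suc m) u))"
    unfolding merge_seq_def Suc nat.case by (intro norm_triangle_le) (simp add: add_nonneg_nonneg)
  also have "\<dots> \<le> (sqrt 2 + 1) * K + 2 * K"
    using norm_embed_retract_coord[of m u] norm_compl_coord[of "Suc m" u] assms
    by (intro add_mono mult_left_mono) (auto simp: add_nonneg_nonneg)
  finally show ?thesis by (simp add: algebra_simps)
qed

lemma norm_merge:
  assumes "norm y \<le> (sqrt 2 + 1) * K" "norm u \<le> K"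
  shows "norm (merge y u) \<le> (3 + sqrt 2) * K"
  unfolding merge_def by (intro norm_join_le norm_merge_seq assms)

lemma coord_merge: "c n (merge y u) = merge_seq y u n"
proof -
  \<comment> \<open>\<open>join\<close> has the prescribed coordinates only for bounded sequences;
    norm y + norm u serves as K because sqrt 2 + 1 \<ge> 1.\<close>
  have "norm y \<le> (sqrt 2 + 1) * (norm y + norm u)"
    by (auto simp: algebra_simps intro!: add_nonneg_nonneg add_increasing)
  then show ?thesis
    unfolding merge_def by (intro coord_join[where K = "(3 + sqrt 2) * (norm y + norm u)"] norm_merge_seq) auto
qed

lemma linear_rest: "linear rest"
  by (rule linearI; rule coord_eqI)
    (simp_all add: coord_rest coord_simps rest_seq_def retract_simps algebra_simps)

lemma merge_add: "merge (y + y') (u + u') = merge y u + merge y' u'"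
  by (rule coord_eqI)
    (simp add: coord_merge coord_simps merge_seq_def retract_simps algebra_simps split: nat.split)

lemma merge_scale: "merge (r *\<^sub>R y) (r *\<^sub>R u) = r *\<^sub>R merge y u"
  by (rule coord_eqI)
    (simp add: coord_merge coord_simps merge_seq_def retract_simps algebra_simps split: nat.split)

text \<open>Since \<open>p\<close> kills complements and \<open>compl\<close> kills the range of
  \<open>g\<close>, the two parts of a coordinate of \<open>rest x\<close> can be read off
  separately.\<close>

lemma merge_split: "merge (p (c 0 x)) (rest x) = x"
proof (rule coord_eqI)
  fix n
  have cmpl: "compl (c n (rest x)) = compl (c n x)" for n
    by (simp add: coord_rest rest_seq_def retract_simps compl_embed compl_compl)
  have gp: "g (p (c n (rest x))) = wt *\<^sub>R g (p (c (Suc n) x))" for n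
    by (simp add: coord_rest rest_seq_def retract_simps retract_compl retract_embed)
  show "c n (merge (p (c 0 x)) (rest x)) = c n x"
    by (simp add: coord_merge merge_seq_def cmpl gp wt embed_retract_compl split: nat.split)
qed

lemma retract_merge: "p (c 0 (merge y u)) = y"
  by (simp add: coord_merge merge_seq_def retract_simps retract_compl retract_embed)

lemma rest_merge: "rest (merge y u) = u"
proof (rule coord_eqI)
  fix n
  have cmpl: "compl (c n (merge y u)) = compl (c n u)" for n
    by (simp add: coord_merge merge_seq_def retract_simps compl_embed compl_compl split: nat.split)
  have gp: "g (p (c (Suc n) (merge y u))) = (sqrt 2 + 1) *\<^sub>R g (p (c n u))" for n
    by (simp add: coord_merge merge_seq_def retract_simps retract_compl retract_embed)
  show "c n (rest (merge y u)) = c n u"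
    by (simp only: coord_rest rest_seq_def cmpl gp scaleR_scaleR wt scaleR_one embed_retract_compl)
qed

lemma norm_retract_coord: "norm (p (c n x)) \<le> norm x"
  using norm_retract norm_coord order_trans by blast

end

theorem banach_mazur_dist_mutual_retracts:
  fixes c :: "nat \<Rightarrow> 'a::real_normed_vector \<Rightarrow> 'a" and d :: "nat \<Rightarrow> 'b::real_normed_vector \<Rightarrow> 'b"
    and g :: "'b \<Rightarrow> 'a" and f :: "'a \<Rightarrow> 'b"
  assumes "power_retract c g p" "power_retract d f q"
  shows "banach_mazur_dist TYPE('a) TYPE('b) \<le> ereal ((3 + sqrt 2)\<^sup>2)"
proof -
  interpret X: power_retract c g p by fact
  interpret Y: power_retract d f q by fact
  \<comment> \<open>The summands swap roles: \<open>X.rest x\<close> lies in 'a and enters 'b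
    through \<open>f\<close>, while \<open>p (c 0 x)\<close> lies in 'b and is shifted to make room
    for it. Their bounds are exactly the hypotheses of \<open>Y.norm_merge\<close> with K = norm
    x.\<close>
  define T where "T x = Y.merge (X.rest x) (p (c 0 x))" for x
  define S where "S y = X.merge (Y.rest y) (q (d 0 y))" for y
  have ST: "S (T x) = x" for x
    by (simp add: S_def T_def Y.rest_merge Y.retract_merge X.merge_split)
  have TS: "T (S y) = y" for y
    by (simp add: S_def T_def X.rest_merge X.retract_merge Y.merge_split)
  have normT: "norm (T x) \<le> norm x * (3 + sqrt 2)" for x
    unfolding T_def using Y.norm_merge[OF X.norm_rest X.norm_retract_coord] by (simp add: mult.commute)
  have normS: "norm (S x) \<le> norm x * (3 + sqrt 2)" for x
    unfolding S_def using X.norm_merge[OF Y.norm_rest Y.norm_retract_coord] by (simp add: mult.commute)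
  have T: "bounded_linear T"
    by (rule bounded_linear_intro[OF _ _ normT])
      (simp_all add: T_def X.coord_simps X.retract_simps Y.merge_add Y.merge_scale
        linear_add[OF X.linear_rest] linear_scale[OF X.linear_rest])
  have S: "bounded_linear S"
    by (rule bounded_linear_intro[OF _ _ normS])
      (simp_all add: S_def Y.coord_simps Y.retract_simps X.merge_add X.merge_scale
        linear_add[OF Y.linear_rest] linear_scale[OF Y.linear_rest])
  have invT: "inv T = S"
    using ST TS by (intro inv_equality)
  have bij: "bij T"
    using ST TS by (intro o_bij[of S]) auto
  have "onorm T \<le> 3 + sqrt 2" "onorm S \<le> 3 + sqrt 2"
    using normT normS by (auto intro!: onorm_bound simp: mult.commute add_nonneg_nonneg)
  then have "onorm T * onorm (inv T) \<le> (3 + sqrt 2)\<^sup>2"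
    unfolding invT power2_eq_square by (intro mult_mono onorm_pos_le S) (auto simp: add_nonneg_nonneg)
  then show ?thesis
    unfolding banach_mazur_dist_def using T S bij invT by (intro INF_lower2[of T]) auto
qed

section \<open>The space of bounded sequences\<close>

lemma norm_linfty_le: "norm (a :: linfty) \<le> K" if "\<And>n. \<bar>apply_bcontfun a n\<bar> \<le> K"
  unfolding linfty_norm using that by (intro cSUP_least) auto

lemma abs_apply_linfty_le: "\<bar>apply_bcontfun (a :: linfty) n\<bar> \<le> norm a"
  using norm_bounded[of a n] by simp

lemma seq_in_bcontfun: "(s :: nat \<Rightarrow> real) \<in> bcontfun" if "\<And>n. \<bar>s n\<bar> \<le> K"
  using that by (intro bcontfun_normI[where b = K]) auto

lemma linfty_power_coord_in_bcontfun:
  "(\<lambda>k. apply_bcontfun (a :: linfty) (prod_encode (n, k))) \<in> bcontfun"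
  by (rule seq_in_bcontfun) (rule abs_apply_linfty_le)

definition linfty_coord :: "nat \<Rightarrow> linfty \<Rightarrow> linfty" where
  "linfty_coord n a = Bcontfun (\<lambda>k. apply_bcontfun a (prod_encode (n, k)))"

lemma apply_linfty_coord:
  "apply_bcontfun (linfty_coord n a) k = apply_bcontfun a (prod_encode (n, k))"
  by (simp add: linfty_coord_def Bcontfun_inverse linfty_power_coord_in_bcontfun)

text \<open>The pairing \<open>prod_encode\<close> cuts the index set into countably many infinite
  rows, and the supremum over all indices is the supremum of the row suprema.\<close>

lemma countable_sup_power_linfty: "countable_sup_power linfty_coord"
proof
  fix n :: nat and a b :: linfty and r K :: real and s :: "nat \<Rightarrow> linfty"
  show "linfty_coord n (a + b) = linfty_coord n a + linfty_coord n b"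
    and "linfty_coord n (r *\<^sub>R a) = r *\<^sub>R linfty_coord n a"
    by (rule bcontfun_eqI; simp add: apply_linfty_coord plus_bcontfun.rep_eq scaleR_bcontfun.rep_eq)+
  show "norm (linfty_coord n a) \<le> norm a"
    by (rule norm_linfty_le) (simp add: apply_linfty_coord abs_apply_linfty_le)
  show "norm a \<le> K" if "\<And>n. norm (linfty_coord n a) \<le> K"
  proof (rule norm_linfty_le)
    fix m
    obtain n k where "m = prod_encode (n, k)" by (metis prod.collapse prod_decode_inverse)
    then show "\<bar>apply_bcontfun a m\<bar> \<le> K"
      using abs_apply_linfty_le[of "linfty_coord n a" k] that[of n] by (simp add: apply_linfty_coord)
  qed
  show "\<exists>x. \<forall>n. linfty_coord n x = s n" if s: "\<And>n. norm (s n) \<le> K"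
  proof -
    define t where "t m = (case prod_decode m of (n, k) \<Rightarrow> apply_bcontfun (s n) k)" for m
    have "\<bar>t m\<bar> \<le> K" for m
      using abs_apply_linfty_le s order_trans by (fastforce simp: t_def split: prod.split)
    then have "t \<in> bcontfun" by (rule seq_in_bcontfun)
    then have "linfty_coord n (Bcontfun t) = s n" for n
      by (intro bcontfun_eqI) (simp add: apply_linfty_coord Bcontfun_inverse t_def)
    then show ?thesis by blast
  qed
qed

text \<open>The evaluations at the points of \<open>\<nat>\<close> lie in a product of compact intervals, and any cluster
  point of this sequence of functionals is a generalised limit.\<close>

lemma ex_generalised_limit:
  obtains L :: "linfty \<Rightarrow> real" where "linear L" "\<And>a. \<bar>L a\<bar> \<le> norm a"
    "\<And>a l. apply_bcontfun a \<longlonglongrightarrow> l \<Longrightarrow> L a = l"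
proof -
  let ?e = "\<lambda>n (a::linfty). apply_bcontfun a n"
  define B where "B = (\<Pi>\<^sub>E a\<in>(UNIV :: linfty set). {- norm a .. norm a})"
  have "compactin (product_topology (\<lambda>_. euclidean) UNIV) B"
    unfolding B_def by (subst compactin_PiE) auto
  then have "compact B"
    by (simp add: euclidean_product_topology)
  moreover have e: "?e n \<in> B" for n
    using abs_apply_linfty_le by (auto simp: B_def abs_le_iff minus_le_iff)
  \<comment> \<open>L is a cluster point, in the topology of pointwise convergence, of the
    evaluations; B is compact by Tychonoff.\<close>
  ultimately obtain L where L: "L \<in> B" "inf (nhds L) (filtermap ?e sequentially) \<noteq> bot"
    unfolding compact_filter by (metis (no_types, lifting) always_eventually eventually_filtermap filtermap_bot_iff trivial_limit_sequentially)
  \<comment> \<open>Every closed condition that holds for almost all evaluations passes to L.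
    Linearity and the value at convergent sequences are both obtained this way.\<close>
  have closedD: "L \<in> C" if "closed C" "eventually (\<lambda>n. ?e n \<in> C) sequentially" for C
  proof (rule ccontr)
    assume "L \<notin> C"
    then have "eventually (\<lambda>x. x \<in> - C) (nhds L)"
      using that(1) by (intro eventually_nhds_in_open) auto
    moreover have "eventually (\<lambda>x. x \<in> C) (filtermap ?e sequentially)"
      using that(2) by (simp add: eventually_filtermap)
    ultimately have "eventually (\<lambda>x. False) (inf (nhds L) (filtermap ?e sequentially))"
      unfolding eventually_inf by blast
    then show False
      using L(2) by (simp add: trivial_limit_def)
  qed
  have coord: "continuous_on UNIV (\<lambda>M :: linfty \<Rightarrow> real. M a)" for a
    by (rule continuous_on_product_coordinates)
  show thesis
  proof
    show "linear L"
    proof (rule linearI)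
      fix a b :: linfty and r :: real
      have "closed {M :: linfty \<Rightarrow> real. M (a + b) = M a + M b}"
        by (intro closed_Collect_eq continuous_intros coord)
      then have "L \<in> {M. M (a + b) = M a + M b}"
        by (rule closedD) (simp add: plus_bcontfun.rep_eq)
      then show "L (a + b) = L a + L b" by simp
      have "closed {M :: linfty \<Rightarrow> real. M (r *\<^sub>R a) = r * M a}"
        by (intro closed_Collect_eq continuous_intros coord)
      then have "L \<in> {M. M (r *\<^sub>R a) = r * M a}"
        by (rule closedD) (simp add: scaleR_bcontfun.rep_eq)
      then show "L (r *\<^sub>R a) = r *\<^sub>R L a" by simp
    qed
    show "\<bar>L a\<bar> \<le> norm a" for a
      using L(1) by (auto simp: B_def PiE_iff abs_le_iff minus_le_iff)
    show "L a = l" if "apply_bcontfun a \<longlonglongrightarrow> l" for a l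
    proof -
      have "\<bar>L a - l\<bar> \<le> r" if "r > 0" for r
      proof -
        have "closed {M :: linfty \<Rightarrow> real. \<bar>M a - l\<bar> \<le> r}"
          by (intro closed_Collect_le continuous_intros coord)
        moreover have "eventually (\<lambda>n. \<bar>apply_bcontfun a n - l\<bar> < r) sequentially"
          using \<open>apply_bcontfun a \<longlonglongrightarrow> l\<close> \<open>r > 0\<close> by (auto simp: tendsto_iff dist_real_def)
        then have "eventually (\<lambda>n. ?e n \<in> {M. \<bar>M a - l\<bar> \<le> r}) sequentially"
          by eventually_elim auto
        ultimately show ?thesis using closedD by blast
      qed
      then have "\<bar>L a - l\<bar> \<le> 0"
        by (rule field_le_epsilon[of _ 0, simplified])
      then show ?thesis by simp
    qed
  qed
qed

section \<open>Dyadic coordinates on \<open>L\<^sub>\<infinity>[0,1]\<close>\<close>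

lemma Linfty01_cases:
  obtains f where "ess_bounded f" "x = abs_Linfty01 f"
  by (induction x rule: Linfty01.abs_induct) auto

lemma norm_abs_Linfty01_le:
  assumes "f \<in> borel_measurable leb01" "AE t in leb01. \<bar>f t\<bar> \<le> K"
  shows "norm (abs_Linfty01 f) \<le> K"
  using ess_boundedI[OF assms] by (simp add: norm_Linfty01.abs_eq)

lemma AE_norm_abs_Linfty01:
  assumes "ess_bounded f"
  shows "AE t in leb01. \<bar>f t\<bar> \<le> norm (abs_Linfty01 f)"
  using AE_ess_norm[OF assms] assms by (simp add: norm_Linfty01.abs_eq)

lemma abs_Linfty01_eqI:
  assumes "ess_bounded f" "ess_bounded g" "AE t in leb01. f t = g t"
  shows "abs_Linfty01 f = abs_Linfty01 g"
  by (rule Quotient_rel_abs[OF Quotient_Linfty01]) (simp add: assms)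

lemma AE_leb01_iff: "(AE t in leb01. P t) \<longleftrightarrow> (AE t in lebesgue. t \<in> {0..1} \<longrightarrow> P t)"
  by (rule AE_restrict_space_iff) simp

text \<open>An affine map of nonzero slope changes Lebesgue measure only by a constant factor, so
  preimages of null sets are null.\<close>

lemma AE_lebesgue_affine:
  fixes c t :: real
  assumes "c \<noteq> 0" "AE x in lebesgue. P x"
  shows "AE x in lebesgue. P (t + c * x)"
proof -
  have m: "(\<lambda>x. t + c * x) \<in> lebesgue \<rightarrow>\<^sub>M lebesgue"
    using lebesgue_affine_measurable[where c = "\<lambda>x::real. c"] assms(1) by simp
  have "AE x in distr lebesgue lebesgue (\<lambda>x. t + c * x). P x"
    using assms(2) by (subst (asm) lebesgue_real_affine[OF assms(1), of t])
      (use assms(1) in \<open>simp add: AE_density\<close>)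
  then show ?thesis
    by (rule AE_distrD[OF m])
qed

text \<open>The increasing affine bijection from [0,1] onto the dyadic piece
  [2^-(n+1), 2^-n].\<close>

definition dyadic_map :: "nat \<Rightarrow> real \<Rightarrow> real" where
  "dyadic_map n t = (1 + t) / 2 ^ Suc n"

definition dyadic_inv :: "nat \<Rightarrow> real \<Rightarrow> real" where
  "dyadic_inv n x = 2 ^ Suc n * x - 1"

definition dyadic_index :: "real \<Rightarrow> nat" where
  "dyadic_index x = nat \<lfloor>- log 2 x\<rfloor>"

lemma dyadic_inverse [simp]: "dyadic_map n (dyadic_inv n x) = x" "dyadic_inv n (dyadic_map n x) = x"
  by (simp_all add: dyadic_map_def dyadic_inv_def)

lemma dyadic_map_affine: "dyadic_map n = (\<lambda>t. 1 / 2 ^ Suc n + 1 / 2 ^ Suc n * t)"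
  by (auto simp: dyadic_map_def add_divide_distrib)

lemma dyadic_inv_affine: "dyadic_inv n = (\<lambda>t. (- 1) + 2 ^ Suc n * t)"
  by (auto simp: dyadic_inv_def)

lemma dyadic_map_measurable: "dyadic_map n \<in> lebesgue \<rightarrow>\<^sub>M lebesgue"
  unfolding dyadic_map_affine
  using lebesgue_affine_measurable[where c = "\<lambda>x::real. 1 / 2 ^ Suc n" and t = "1 / 2 ^ Suc n"] by simp

lemma dyadic_inv_measurable: "dyadic_inv n \<in> lebesgue \<rightarrow>\<^sub>M lebesgue"
  unfolding dyadic_inv_affine
  using lebesgue_affine_measurable[where c = "\<lambda>x::real. 2 ^ Suc n" and t = "-1"] by simp

lemma dyadic_map_01: "t \<in> {0..1} \<Longrightarrow> dyadic_map n t \<in> {0..1}"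
proof -
  assume t: "t \<in> {0..1}"
  have "1 + t \<le> 2 * 2 ^ n"
    using t one_le_power[of "2::real" n] unfolding atLeastAtMost_iff by linarith
  then show ?thesis
    using t by (simp add: dyadic_map_def)
qed

lemma dyadic_map_measurable_leb01 [measurable]: "dyadic_map n \<in> leb01 \<rightarrow>\<^sub>M leb01"
  using dyadic_map_01 by (intro measurable_restrict_space3 dyadic_map_measurable) auto

lemma dyadic_index_measurable [measurable]: "dyadic_index \<in> leb01 \<rightarrow>\<^sub>M count_space UNIV"
proof -
  have "dyadic_index \<in> lborel \<rightarrow>\<^sub>M count_space UNIV"
    unfolding dyadic_index_def by measurable
  then show ?thesis
    by (intro measurable_restrict_space1 measurable_completion)
qed

text \<open>Here -log 2 of the image is n + 1 - log 2 (1 + t) with the last logarithm in (0,1]. At t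
  = 0 the image 2^-(n+1) already has index n + 1, so the pieces are taken half open.\<close>

lemma dyadic_index_eq:
  assumes "0 < t" "t \<le> 1"
  shows "dyadic_index (dyadic_map n t) = n"
proof -
  have "log 2 (dyadic_map n t) = log 2 (1 + t) - real (Suc n)"
    using assms by (simp add: dyadic_map_def log_divide log_nat_power del: power_Suc)
  moreover have "0 < log 2 (1 + t)" "log 2 (1 + t) \<le> 1"
    using assms by (auto simp: log_le_one_cancel_iff)
  ultimately have "\<lfloor>- log 2 (dyadic_map n t)\<rfloor> = int n"
    by (intro floor_unique) auto
  then show ?thesis by (simp add: dyadic_index_def)
qed

lemma dyadic_inv_index:
  assumes "0 < x" "x \<le> 1"
  shows "dyadic_inv (dyadic_index x) x \<in> {0..1}"
proof -
  define n where "n = dyadic_index x"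
  have "0 \<le> - log 2 x" using assms by simp
  then have "real n \<le> - log 2 x" "- log 2 x < real n + 1"
    unfolding n_def dyadic_index_def by linarith+
  then have "log 2 x \<le> - real n" "- real (Suc n) < log 2 x" by auto
  then have "x \<le> 2 powr (- real n)" "2 powr (- real (Suc n)) < x"
    using assms by (simp_all add: log_le_iff less_log_iff)
  then have "x \<le> 1 / 2 ^ n" "1 / 2 ^ Suc n < x"
    by (simp_all add: powr_minus powr_realpow divide_inverse del: of_nat_Suc power_Suc)
  then show ?thesis
    unfolding n_def[symmetric] by (simp add: dyadic_inv_def field_simps)
qed

text \<open>Countably many pieces cover [0,1] up to the point 0, and the affine maps onto them
  preserve null sets in both directions. Every statement about the coordinates is reduced to this
  equivalence.\<close>

lemma AE_leb01_dyadic_iff: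
  "(AE x in leb01. P x) \<longleftrightarrow> (\<forall>n. AE t in leb01. P (dyadic_map n t))"
proof (intro iffI allI)
  fix n
  assume "AE x in leb01. P x"
  then have "AE x in lebesgue. x \<in> {0..1} \<longrightarrow> P x"
    by (simp only: AE_leb01_iff)
  then have "AE t in lebesgue. dyadic_map n t \<in> {0..1} \<longrightarrow> P (dyadic_map n t)"
    unfolding dyadic_map_affine by (rule AE_lebesgue_affine[rotated]) simp
  then show "AE t in leb01. P (dyadic_map n t)"
    unfolding AE_leb01_iff by eventually_elim (use dyadic_map_01 in blast)
next
  assume *: "\<forall>n. AE t in leb01. P (dyadic_map n t)"
  have "AE x in lebesgue. dyadic_inv n x \<in> {0..1} \<longrightarrow> P x" for n
  proof -
    have "AE t in lebesgue. t \<in> {0..1} \<longrightarrow> P (dyadic_map n t)"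
      using * by (simp only: AE_leb01_iff)
    then have "AE x in lebesgue. dyadic_inv n x \<in> {0..1} \<longrightarrow> P (dyadic_map n (dyadic_inv n x))"
      unfolding dyadic_inv_affine by (rule AE_lebesgue_affine[rotated]) simp
    then show ?thesis by simp
  qed
  then have "AE x in lebesgue. \<forall>n. dyadic_inv n x \<in> {0..1} \<longrightarrow> P x"
    unfolding AE_all_countable by blast
  moreover have "AE x in lebesgue. x \<noteq> (0::real)"
    by (rule AE_completion) (rule AE_lborel_singleton)
  ultimately show "AE x in leb01. P x"
    unfolding AE_leb01_iff
  proof eventually_elim
    case (elim x)
    then show ?case using dyadic_inv_index[of x] by (metis atLeastAtMost_iff order_le_less)
  qed
qed

section \<open>Coordinates along the dyadic pieces\<close>

lemma ess_bounded_dyadic: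
  assumes "ess_bounded f"
  shows "ess_bounded (\<lambda>t. f (dyadic_map n t))"
proof -
  have [measurable]: "f \<in> borel_measurable leb01"
    using assms by (rule ess_bounded_measurable)
  have "AE t in leb01. \<bar>f (dyadic_map n t)\<bar> \<le> ess_norm f"
    using AE_leb01_dyadic_iff[of "\<lambda>x. \<bar>f x\<bar> \<le> ess_norm f"] AE_ess_norm[OF assms] by blast
  then show ?thesis
    by (intro ess_boundedI(1)) measurable
qed

lift_definition Linfty01_coord :: "nat \<Rightarrow> Linfty01 \<Rightarrow> Linfty01" is "\<lambda>n f t. f (dyadic_map n t)"
proof (intro conjI; elim conjE)
  fix n and f g :: "real \<Rightarrow> real"
  assume "AE x in leb01. f x = g x"
  then show "AE t in leb01. f (dyadic_map n t) = g (dyadic_map n t)"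
    by (rule AE_leb01_dyadic_iff[THEN iffD1, rule_format])
qed (rule ess_bounded_dyadic, assumption)+

lemma Linfty01_coord_abs:
  "ess_bounded f \<Longrightarrow> Linfty01_coord n (abs_Linfty01 f) = abs_Linfty01 (\<lambda>t. f (dyadic_map n t))"
  by (simp add: Linfty01_coord.abs_eq)

lemma plus_abs_Linfty01: "ess_bounded f \<Longrightarrow> ess_bounded g \<Longrightarrow>
    abs_Linfty01 f + abs_Linfty01 g = abs_Linfty01 (\<lambda>t. f t + g t)"
  by (simp add: plus_Linfty01.abs_eq)

lemma scaleR_abs_Linfty01: "ess_bounded f \<Longrightarrow>
    r *\<^sub>R abs_Linfty01 f = abs_Linfty01 (\<lambda>t. r * f t)"
  by (simp add: scaleR_Linfty01.abs_eq)

lemma AE_leb01_pos: "AE t in leb01. 0 < t \<and> t \<le> 1"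
proof -
  have "AE x in lebesgue. x \<noteq> (0::real)"
    by (rule AE_completion) (rule AE_lborel_singleton)
  then show ?thesis
    unfolding AE_leb01_iff by eventually_elim auto
qed

lemma ex_Linfty01_coord:
  assumes "\<And>n. norm (s n) \<le> K"
  shows "\<exists>x. \<forall>n. Linfty01_coord n x = s n"
proof -
  have "\<forall>n. \<exists>f. ess_bounded f \<and> s n = abs_Linfty01 f"
    using Linfty01_cases by metis
  then obtain f where f: "\<And>n. ess_bounded (f n)" "\<And>n. s n = abs_Linfty01 (f n)"
    by metis
  \<comment> \<open>\<open>f n\<close> is measurable only on [0,1], while
    \<open>dyadic_inv n\<close> leaves that interval; extending by 0 makes each composition
    measurable before the pieces are glued.\<close>
  define h where "h n t = (if t \<in> {0..1} then f n t else 0)" for n t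
  have h: "h n \<in> borel_measurable lebesgue" for n
    unfolding h_def using f(1)[of n] by (intro borel_measurable_if_I ess_bounded_measurable) auto
  define F where "F x = h (dyadic_index x) (dyadic_inv (dyadic_index x) x)" for x
  have [measurable]: "(\<lambda>x. h n (dyadic_inv n x)) \<in> borel_measurable leb01" for n
    using measurable_compose[OF dyadic_inv_measurable h] by (rule measurable_restrict_space1)
  have F [measurable]: "F \<in> borel_measurable leb01"
    unfolding F_def by (rule measurable_compose_countable) measurable
  have Ff: "AE t in leb01. F (dyadic_map n t) = f n t" for n
    using AE_leb01_pos by eventually_elim (simp add: F_def h_def dyadic_index_eq)
  have "AE t in leb01. \<bar>F (dyadic_map n t)\<bar> \<le> K" for n
    using Ff[of n] AE_norm_abs_Linfty01[OF f(1)[of n]]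
  proof eventually_elim
    case (elim t)
    then show ?case using assms[of n] by (simp add: f(2))
  qed
  then have Fb: "ess_bounded F"
    by (intro ess_boundedI(1)[OF F, of K], subst AE_leb01_dyadic_iff) blast
  have "Linfty01_coord n (abs_Linfty01 F) = s n" for n
    unfolding f(2) Linfty01_coord_abs[OF Fb] by (intro abs_Linfty01_eqI ess_bounded_dyadic Fb f Ff)
  then show ?thesis by blast
qed

lemma countable_sup_power_Linfty01: "countable_sup_power Linfty01_coord"
proof
  fix n :: nat and x y :: Linfty01 and r K :: real and s :: "nat \<Rightarrow> Linfty01"
  obtain f g where f: "ess_bounded f" "x = abs_Linfty01 f" and g: "ess_bounded g" "y = abs_Linfty01 g"
    using Linfty01_cases by metis
  show "Linfty01_coord n (x + y) = Linfty01_coord n x + Linfty01_coord n y"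
    and "Linfty01_coord n (r *\<^sub>R x) = r *\<^sub>R Linfty01_coord n x"
    using f g by (simp_all add: plus_abs_Linfty01 scaleR_abs_Linfty01 Linfty01_coord_abs
        ess_bounded_add ess_bounded_scale ess_bounded_dyadic)
  have AE: "AE t in leb01. \<bar>f (dyadic_map n t)\<bar> \<le> norm (Linfty01_coord n x)" for n
    using AE_norm_abs_Linfty01[OF ess_bounded_dyadic[OF f(1), of n]] f by (simp add: Linfty01_coord_abs)
  have "AE t in leb01. \<bar>f (dyadic_map n t)\<bar> \<le> norm x"
    using AE_norm_abs_Linfty01[OF f(1)] unfolding f(2)[symmetric] by (subst (asm) AE_leb01_dyadic_iff) blast
  then show "norm (Linfty01_coord n x) \<le> norm x"
    unfolding f(2) Linfty01_coord_abs[OF f(1)]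
    using ess_bounded_measurable[OF ess_bounded_dyadic[OF f(1)]] by (intro norm_abs_Linfty01_le)
  show "norm x \<le> K" if "\<And>n. norm (Linfty01_coord n x) \<le> K"
    unfolding f(2)
  proof (rule norm_abs_Linfty01_le)
    show "f \<in> borel_measurable leb01" using f(1) by (rule ess_bounded_measurable)
    have "AE t in leb01. \<bar>f (dyadic_map n t)\<bar> \<le> K" for n
      using AE[of n] by eventually_elim (use that[of n] in linarith)
    then show "AE t in leb01. \<bar>f t\<bar> \<le> K" by (subst AE_leb01_dyadic_iff) blast
  qed
  show "\<exists>x. \<forall>n. Linfty01_coord n x = s n" if "\<And>n. norm (s n) \<le> K"
    using that by (rule ex_Linfty01_coord)
qed

section \<open>Elements of \<open>L\<^sub>\<infinity>[0,1]\<close> as set functions\<close>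

interpretation leb01: finite_measure leb01
  by (rule finite_measureI) (simp add: emeasure_restrict_space)

lemma sets_leb01_subset: "A \<in> sets leb01 \<Longrightarrow> A \<subseteq> {0..1}"
  using sets.sets_into_space[of A leb01] by simp

lemma LINT_indicator_leb01:
  "A \<in> sets leb01 \<Longrightarrow> (LINT t|leb01. K * indicator A t) = K * measure leb01 A" for K :: real
  using sets_leb01_subset[of A] by (simp add: Int_absorb2)

lemma integrable_indicator_leb01:
  "A \<in> sets leb01 \<Longrightarrow> integrable leb01 (\<lambda>t. K * indicator A t :: real)"
  by (intro integrable_mult_right integrable_real_indicator) (auto simp: less_top[symmetric])

lemma ess_bounded_integrable:
  assumes "ess_bounded f" "A \<in> sets leb01"
  shows "integrable leb01 (\<lambda>t. indicator A t * f t)"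
proof -
  have [measurable]: "f \<in> borel_measurable leb01" "A \<in> sets leb01"
    using assms by (auto intro: ess_bounded_measurable)
  have "AE t in leb01. norm (indicator A t * f t) \<le> ess_norm f"
    using AE_ess_norm[OF assms(1)] by eventually_elim (auto simp: indicator_def)
  then show ?thesis
    by (intro leb01.integrable_const_bound) measurable
qed

text \<open>The pairing with an indicator function. As a set function of A it determines x and its
  norm, so elements can be built and compared without choosing representatives.\<close>

definition integral_over :: "real set \<Rightarrow> Linfty01 \<Rightarrow> real" where
  "integral_over A x = (LINT t|leb01. indicator A t * rep_Linfty01 x t)"

lemma integral_over_abs:
  assumes f: "ess_bounded f" and [measurable]: "A \<in> sets leb01"
  shows "integral_over A (abs_Linfty01 f) = (LINT t|leb01. indicator A t * f t)"
proof -
  have *: "ess_bounded (rep_Linfty01 (abs_Linfty01 f)) \<and> ess_bounded f \<and>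
      (AE t in leb01. rep_Linfty01 (abs_Linfty01 f) t = f t)"
    by (rule Quotient_rep_abs[OF Quotient_Linfty01]) (use f in auto)
  then have [measurable]: "f \<in> borel_measurable leb01"
    "rep_Linfty01 (abs_Linfty01 f) \<in> borel_measurable leb01"
    by (auto intro: ess_bounded_measurable)
  have "AE t in leb01. indicator A t * rep_Linfty01 (abs_Linfty01 f) t = indicator A t * f t"
    using * by (auto elim: eventually_mono)
  then show ?thesis
    unfolding integral_over_def by (intro integral_cong_AE) measurable
qed

lemma linear_integral_over:
  assumes "A \<in> sets leb01"
  shows "linear (integral_over A)"
proof (rule linearI)
  fix x y :: Linfty01 and r :: real
  obtain f g where f: "ess_bounded f" "x = abs_Linfty01 f" and g: "ess_bounded g" "y = abs_Linfty01 g"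
    using Linfty01_cases by metis
  note int = ess_bounded_integrable[OF f(1) assms] ess_bounded_integrable[OF g(1) assms]
  show "integral_over A (x + y) = integral_over A x + integral_over A y"
    using f g assms Bochner_Integration.integral_add[OF int]
    by (simp add: plus_abs_Linfty01 integral_over_abs ess_bounded_add distrib_left)
  show "integral_over A (r *\<^sub>R x) = r *\<^sub>R integral_over A x"
    using f assms
    by (simp add: scaleR_abs_Linfty01 integral_over_abs ess_bounded_scale mult.left_commute)
qed

lemma abs_integral_over_le:
  assumes "A \<in> sets leb01"
  shows "\<bar>integral_over A x\<bar> \<le> norm x * measure leb01 A"
proof -
  obtain f where f: "ess_bounded f" "x = abs_Linfty01 f"
    using Linfty01_cases by metis
  have "\<bar>integral_over A x\<bar> \<le> (LINT t|leb01. norm (indicator A t * f t))"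
    unfolding f(2) integral_over_abs[OF f(1) assms] real_norm_def[symmetric]
    by (rule integral_norm_bound)
  also have "\<dots> \<le> (LINT t|leb01. norm x * indicator A t)"
  proof (rule integral_mono_AE)
    show "integrable leb01 (\<lambda>t. norm x * indicator A t)"
      using assms by (rule integrable_indicator_leb01)
    show "AE t in leb01. norm (indicator A t * f t) \<le> norm x * indicator A t"
      using AE_norm_abs_Linfty01[OF f(1)] unfolding f(2) by eventually_elim (simp add: indicator_def)
  qed (intro integrable_norm ess_bounded_integrable f assms)
  also have "\<dots> = norm x * measure leb01 A"
    using assms by (rule LINT_indicator_leb01)
  finally show ?thesis .
qed

section \<open>Norm, uniqueness and existence from integrals over sets\<close>

lemma AE_le_of_integral_le:
  fixes f :: "real \<Rightarrow> real"
  assumes int: "integrable leb01 f"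
    and le: "\<And>A. A \<in> sets leb01 \<Longrightarrow> (LINT t|leb01. indicator A t * f t) \<le> K * measure leb01 A"
  shows "AE t in leb01. f t \<le> K"
proof -
  have [measurable]: "f \<in> borel_measurable leb01" using int by auto
  \<comment> \<open>The hypothesis is tested on the set where the bound fails: there f - K is
    positive with integral at most 0, so the set is null.\<close>
  define A where "A = {t \<in> space leb01. K < f t}"
  have A [measurable]: "A \<in> sets leb01" unfolding A_def by measurable
  have intA: "integrable leb01 (\<lambda>t. indicator A t * f t)"
    using integrable_mult_indicator[OF A int] by simp
  have intK: "integrable leb01 (\<lambda>t. K * indicator A t)"
    by (rule integrable_indicator_leb01[OF A])
  have int': "integrable leb01 (\<lambda>t. indicator A t * f t - K * indicator A t)"
    by (intro Bochner_Integration.integrable_diff intA intK)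
  have nn: "0 \<le> indicator A t * f t - K * indicator A t" for t
    by (auto simp: A_def indicator_def)
  have "(LINT t|leb01. indicator A t * f t - K * indicator A t) \<le> 0"
    using le[OF A] unfolding Bochner_Integration.integral_diff[OF intA intK] LINT_indicator_leb01[OF A] by simp
  then have "(LINT t|leb01. indicator A t * f t - K * indicator A t) = 0"
    using Bochner_Integration.integral_nonneg[OF nn] by (intro antisym)
  then have "AE t in leb01. indicator A t * f t - K * indicator A t = 0"
    using integral_nonneg_eq_0_iff_AE[OF int'] nn by simp
  then show ?thesis
    using AE_space by eventually_elim (auto simp: A_def indicator_def)
qed

lemma norm_Linfty01_le_of_integral_over:
  assumes "\<And>A. A \<in> sets leb01 \<Longrightarrow> \<bar>integral_over A x\<bar> \<le> K * measure leb01 A"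
  shows "norm x \<le> K"
proof -
  obtain f where f: "ess_bounded f" "x = abs_Linfty01 f"
    using Linfty01_cases by metis
  have int: "integrable leb01 f"
    using ess_bounded_integrable[OF f(1), of "{0..1}"]
    by (rule Bochner_Integration.integrable_cong[THEN iffD1, rotated -1]) auto
  have bd: "\<bar>LINT t|leb01. indicator A t * f t\<bar> \<le> K * measure leb01 A" if "A \<in> sets leb01" for A
    using assms[OF that] that f by (simp add: integral_over_abs)
  have "AE t in leb01. f t \<le> K"
    using bd by (intro AE_le_of_integral_le int) (use abs_le_D1 in blast)
  moreover have "AE t in leb01. - f t \<le> K"
    using bd int by (intro AE_le_of_integral_le) (auto simp: abs_le_iff)
  ultimately have "AE t in leb01. \<bar>f t\<bar> \<le> K"
    by eventually_elim auto
  then show ?thesis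
    unfolding f(2) using f(1) by (intro norm_abs_Linfty01_le ess_bounded_measurable)
qed

lemma Linfty01_eqI_integral_over:
  assumes "\<And>A. A \<in> sets leb01 \<Longrightarrow> integral_over A x = integral_over A y"
  shows "x = y"
proof -
  have "norm (x - y) \<le> 0"
    using assms by (intro norm_Linfty01_le_of_integral_over)
      (simp add: linear_diff[OF linear_integral_over])
  then show ?thesis by simp
qed

text \<open>Finite additivity is all that a generalised limit of measures offers. Domination by
  Lebesgue measure upgrades it to countable additivity, and the Radon-Nikodym theorem then gives a
  density.\<close>

lemma ex_Linfty01_density:
  fixes \<nu> :: "real set \<Rightarrow> real"
  assumes add: "\<And>A B. A \<in> sets leb01 \<Longrightarrow> B \<in> sets leb01 \<Longrightarrow> A \<inter> B = {} \<Longrightarrow> \<nu> (A \<union> B) = \<nu> A + \<nu> B"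
    and bound: "\<And>A. A \<in> sets leb01 \<Longrightarrow> \<bar>\<nu> A\<bar> \<le> K * measure leb01 A"
  obtains x where "\<And>A. A \<in> sets leb01 \<Longrightarrow> integral_over A x = \<nu> A"
proof -
  \<comment> \<open>The shift makes the set function nonnegative, with 0 \<le> \<mu> \<le> 2 K times
    the measure; it is undone at the end by subtracting K from the density.\<close>
  define \<mu> where "\<mu> A = \<nu> A + K * measure leb01 A" for A
  have \<mu>: "0 \<le> \<mu> A" "\<mu> A \<le> 2 * K * measure leb01 A" if "A \<in> sets leb01" for A
    using bound[OF that] by (auto simp: \<mu>_def)
  have \<mu>_add: "\<mu> (A \<union> B) = \<mu> A + \<mu> B" if "A \<in> sets leb01" "B \<in> sets leb01" "A \<inter> B = {}" for A B
    using add[OF that] leb01.finite_measure_Union[OF that] by (simp add: \<mu>_def distrib_left)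
  define N where "N = measure_of (space leb01) (sets leb01) (\<lambda>A. ennreal (\<mu> A))"
  have sets_N: "sets N = sets leb01" unfolding N_def by (rule sets.sets_measure_of_eq)
  have \<mu>_empty: "\<mu> {} = 0" using \<mu>[of "{}"] by simp
  have "countably_additive (sets leb01) (\<lambda>A. ennreal (\<mu> A))"
  proof (rule sets.empty_continuous_imp_countably_additive)
    show "positive (sets leb01) (\<lambda>A. ennreal (\<mu> A))"
      by (simp add: positive_def \<mu>_empty)
    show "additive (sets leb01) (\<lambda>A. ennreal (\<mu> A))"
      by (auto simp: additive_def \<mu>_add ennreal_plus[symmetric] \<mu> simp del: ennreal_plus)
    show "\<forall>A\<in>sets leb01. ennreal (\<mu> A) \<noteq> \<infinity>" by simp
    fix A :: "nat \<Rightarrow> real set"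
    assume A: "range A \<subseteq> sets leb01" "decseq A" "(\<Inter>i. A i) = {}"
    \<comment> \<open>Continuity at the empty set is inherited from the dominating measure.\<close>
    have "(\<lambda>i. measure leb01 (A i)) \<longlonglongrightarrow> measure leb01 (\<Inter>i. A i)"
      by (rule leb01.finite_Lim_measure_decseq[OF A(1,2)])
    then have "(\<lambda>i. 2 * K * measure leb01 (A i)) \<longlonglongrightarrow> 2 * K * 0"
      using A(3) by (intro tendsto_intros) simp
    then have "(\<lambda>i. \<mu> (A i)) \<longlonglongrightarrow> 0"
      using A(1) \<mu> by (intro tendsto_sandwich[of "\<lambda>_. 0" "\<lambda>i. \<mu> (A i)" sequentially "\<lambda>i. 2 * K * measure leb01 (A i)"])
        (auto intro!: always_eventually)
    then show "(\<lambda>i. ennreal (\<mu> (A i))) \<longlonglongrightarrow> 0"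
      using tendsto_ennrealI by fastforce
  qed
  then have em_N: "emeasure N A = ennreal (\<mu> A)" if "A \<in> sets leb01" for A
    using that sets.space_closed[of leb01]
    by (intro emeasure_measure_of[OF N_def]) (simp_all add: sets_N positive_def \<mu>_empty)
  have "absolutely_continuous leb01 N"
    unfolding absolutely_continuous_def
  proof
    fix A assume A: "A \<in> null_sets leb01"
    then have "A \<in> sets leb01" "measure leb01 A = 0" by (auto simp: measure_def)
    then show "A \<in> null_sets N"
      using \<mu>[of A] by (auto simp: null_sets_def sets_N em_N)
  qed
  then obtain h where h [measurable]: "h \<in> borel_measurable leb01" and hN: "density leb01 h = N"
    using leb01.Radon_Nikodym sets_N by blast
  have nn_h: "(\<integral>\<^sup>+t. h t * indicator A t \<partial>leb01) = ennreal (\<mu> A)" if "A \<in> sets leb01" for A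
    using em_N[OF that] emeasure_density[OF h that] by (simp add: hN)
  have "(\<integral>\<^sup>+t. h t \<partial>leb01) = (\<integral>\<^sup>+t. h t * indicator {0..1} t \<partial>leb01)"
    by (rule nn_integral_cong) auto
  then have nn_h1: "(\<integral>\<^sup>+t. h t \<partial>leb01) = ennreal (\<mu> {0..1})"
    using nn_h[of "{0..1}"] by simp
  have fin: "AE t in leb01. h t \<noteq> \<infinity>"
    by (rule nn_integral_noteq_infinite) (simp_all add: nn_h1)
  define k where "k t = enn2real (h t)" for t
  have [measurable]: "k \<in> borel_measurable leb01" unfolding k_def by measurable
  have k0: "0 \<le> k t" for t by (simp add: k_def)
  have kh: "AE t in leb01. ennreal (k t) = h t"
    using fin by eventually_elim (simp add: k_def top.not_eq_extremum)
  have int_k: "integrable leb01 k"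
  proof (rule integrableI_nonneg)
    have "(\<integral>\<^sup>+t. ennreal (k t) \<partial>leb01) = (\<integral>\<^sup>+t. h t \<partial>leb01)"
      using kh by (rule nn_integral_cong_AE)
    then show "(\<integral>\<^sup>+t. ennreal (k t) \<partial>leb01) < \<infinity>"
      by (simp add: nn_h1)
  qed (use k0 in auto)
  have LINT_k: "(LINT t|leb01. indicator A t * k t) = \<mu> A" if [measurable]: "A \<in> sets leb01" for A
  proof -
    have "(\<integral>\<^sup>+t. ennreal (indicator A t * k t) \<partial>leb01) = (\<integral>\<^sup>+t. h t * indicator A t \<partial>leb01)"
      using kh by (intro nn_integral_cong_AE) (auto elim!: eventually_mono simp: indicator_def)
    then have "(\<integral>\<^sup>+t. ennreal (indicator A t * k t) \<partial>leb01) = ennreal (\<mu> A)"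
      using nn_h[OF that] by simp
    then show ?thesis
      by (intro integral_eq_nn_integral[THEN trans]) (auto simp: k0 \<mu>[OF that])
  qed
  have "AE t in leb01. k t \<le> 2 * K"
    using \<mu> LINT_k by (intro AE_le_of_integral_le int_k) auto
  then have "AE t in leb01. \<bar>k t - K\<bar> \<le> K"
    by eventually_elim (use k0 in \<open>auto simp: abs_le_iff\<close>)
  then have eb: "ess_bounded (\<lambda>t. k t - K)"
    by (intro ess_boundedI(1)) measurable
  show thesis
  proof
    fix A assume A [measurable]: "A \<in> sets leb01"
    have "integral_over A (abs_Linfty01 (\<lambda>t. k t - K)) = (LINT t|leb01. indicator A t * k t - K * indicator A t)"
      unfolding integral_over_abs[OF eb A] by (simp add: algebra_simps)
    also have "\<dots> = \<mu> A - K * measure leb01 A"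
    proof (subst Bochner_Integration.integral_diff)
      show "integrable leb01 (\<lambda>t. indicator A t * k t)"
        using integrable_mult_indicator[OF A int_k] by simp
    qed (simp_all only: LINT_k LINT_indicator_leb01 integrable_indicator_leb01 A)
    finally show "integral_over A (abs_Linfty01 (\<lambda>t. k t - K)) = \<nu> A"
      by (simp add: \<mu>_def)
  qed
qed

section \<open>Uniqueness from integrals over initial intervals\<close>

lemma measure_leb01: "A \<in> sets leb01 \<Longrightarrow> measure leb01 A = measure lebesgue A"
  using sets_leb01_subset[of A] by (intro measure_restrict_space) auto

lemma sets_leb01_I: "A \<in> sets lebesgue \<Longrightarrow> A \<inter> {0..1} \<in> sets leb01"
  by (auto simp: sets_restrict_space)

lemma atLeastAtMost_01_in_sets [simp]: "{0..1} \<in> sets leb01"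
  by (metis sets.top space_lebesgue_on)

lemma atLeastAtMost_in_sets_leb01: "s \<le> 1 \<Longrightarrow> {0..s} \<in> sets leb01"
  using sets_leb01_I[of "{0..s}"] by (simp add: min_def)

lemma integral_over_null: "A \<in> sets leb01 \<Longrightarrow> measure leb01 A = 0 \<Longrightarrow> integral_over A x = 0"
  using abs_integral_over_le[of A x] by simp

lemma integral_over_empty: "integral_over {} x = 0"
  by (simp add: integral_over_null)

lemma integral_over_UN:
  assumes A: "\<And>i::nat. A i \<in> sets leb01" and disj: "disjoint_family A"
  shows "integral_over (\<Union>i. A i) x = (\<Sum>i. integral_over (A i) x)"
proof -
  obtain f where f: "ess_bounded f" "x = abs_Linfty01 f"
    using Linfty01_cases by metis
  have U: "(\<Union>i. A i) \<in> sets leb01" using A by blast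
  have "(LINT t:(\<Union>i. A i)|leb01. f t) = (\<Sum>i. LINT t:A i|leb01. f t)"
    using ess_bounded_integrable[OF f(1) U] disj
    by (intro lebesgue_integral_countable_add A) (auto simp: set_integrable_def disjoint_family_on_def)
  then show ?thesis
    unfolding f(2) integral_over_abs[OF f(1) U] integral_over_abs[OF f(1) A]
    by (simp add: set_lebesgue_integral_def)
qed

lemma integral_over_Un:
  assumes "A \<in> sets leb01" "B \<in> sets leb01" "A \<inter> B = {}"
  shows "integral_over (A \<union> B) x = integral_over A x + integral_over B x"
proof -
  obtain f where f: "ess_bounded f" "x = abs_Linfty01 f"
    using Linfty01_cases by metis
  have "indicator (A \<union> B) t = (indicator A t + indicator B t :: real)" for t
    using assms(3) by (auto simp: indicator_def)
  then show ?thesis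
    using assms f
    by (simp add: integral_over_abs distrib_right ess_bounded_integrable Bochner_Integration.integral_add)
qed

lemma integral_over_Diff:
  assumes "A \<in> sets leb01" "B \<in> sets leb01" "B \<subseteq> A"
  shows "integral_over (A - B) x = integral_over A x - integral_over B x"
proof -
  have "(A - B) \<union> B = A" "(A - B) \<inter> B = {}" using assms(3) by auto
  then show ?thesis
    using integral_over_Un[of "A - B" B x] assms by auto
qed

text \<open>Dynkin's argument: the half-lines are stable under intersection and generate the Borel
  sets, and the sets with vanishing integral are closed under complements and disjoint countable
  unions.\<close>

lemma Linfty01_eq_0I_intervals:
  assumes "\<And>s. s \<in> {0..1} \<Longrightarrow> integral_over {0..s} z = 0"
  shows "z = 0"
proof -
  have lin0: "integral_over A 0 = 0" if "A \<in> sets leb01" for A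
    using linear_0[OF linear_integral_over[OF that]] .
  have borel: "integral_over (A \<inter> {0..1}) z = 0" if "A \<in> sets borel" for A
  proof -
    have A: "A \<in> sigma_sets UNIV (range (\<lambda>s::real. {..s}))"
      using that by (subst (asm) borel_eq_atMost) simp
    have stable: "Int_stable (range (\<lambda>s::real. {..s}))"
      by (auto simp: Int_stable_def)
    have sb: "B \<inter> {0..1} \<in> sets leb01"
      if "B \<in> sigma_sets UNIV (range (\<lambda>s::real. {..s}))" for B
    proof -
      have "B \<in> sets borel" using that by (subst borel_eq_atMost) simp
      then show ?thesis by (intro sets_leb01_I) simp
    qed
    have "range (\<lambda>s::real. {..s}) \<subseteq> Pow UNIV" by simp
    from stable this A show ?thesis
    proof (induction rule: sigma_sets_induct_disjoint)
      case (basic B)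
      then obtain s where B: "B = {..s}" by auto
      show ?case
      proof (cases "s < 0")
        case True
        then have "B \<inter> {0..1} = {}" by (auto simp: B)
        then show ?thesis by (simp add: integral_over_empty)
      next
        case False
        then have "B \<inter> {0..1} = {0..min s 1}" by (auto simp: B)
        then show ?thesis using assms[of "min s 1"] False by auto
      qed
    next
      case empty
      then show ?case by (simp add: integral_over_empty)
    next
      case (compl B)
      have "(UNIV - B) \<inter> {0..1} = {0..1} - B \<inter> {0..1}" by auto
      \<comment> \<open>The complement is taken inside [0,1], whose own integral vanishes by the
        case s = 1.\<close>
      then show ?case
        using compl sb assms[of 1] by (simp add: integral_over_Diff)
    next
      case (union B)
      have eq: "(\<Union>i. B i) \<inter> {0..1} = (\<Union>i. B i \<inter> {0..1})" by auto
      have "disjoint_family (\<lambda>i. B i \<inter> {0..1})"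
        using union by (auto simp: disjoint_family_on_def)
      moreover have "B i \<inter> {0..1} \<in> sets leb01" for i
        using union sb by blast
      ultimately show ?case
        unfolding eq using union by (subst integral_over_UN) auto
    qed
  qed
  show ?thesis
  proof (rule Linfty01_eqI_integral_over)
    fix A assume A: "A \<in> sets leb01"
    then have "A \<in> sets (completion lborel)"
      by (auto simp: sets_restrict_space)
    \<comment> \<open>A Lebesgue set is a Borel set up to a null set, over which the integral is
      0.\<close>
    then obtain S N N' where S: "A = S \<union> N" "N \<subseteq> N'" "N' \<in> null_sets lborel" "S \<in> sets lborel"
      by (rule sets_completionE)
    have SA: "S \<inter> {0..1} = S" "S \<subseteq> A"
      using S sets_leb01_subset[OF A] by auto
    then have S': "S \<in> sets leb01" using sets_leb01_I[of S] S by simp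
    have "N' \<in> null_sets lebesgue" using S by (intro null_sets_completionI)
    then have "A - S \<in> null_sets lebesgue"
      by (rule null_sets_completion_subset[rotated]) (use S in auto)
    then have "measure leb01 (A - S) = 0"
      using A S' by (subst measure_leb01) (auto simp: measure_def)
    then have "integral_over (A - S) z = 0"
      using A S' by (intro integral_over_null) auto
    then show "integral_over A z = integral_over A 0"
      using borel[of S] S SA A S' by (simp add: lin0 integral_over_Diff)
  qed
qed

section \<open>The bounded sequences as a retract of \<open>Linfty01\<close>\<close>

lemma apply_Bcontfun_bounded:
  "(\<And>n. \<bar>s n\<bar> \<le> K) \<Longrightarrow> apply_bcontfun (Bcontfun s :: linfty) n = s n"
  by (subst Bcontfun_inverse) (auto intro: seq_in_bcontfun)

lemma ess_bounded_const: "ess_bounded (\<lambda>t. c)"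
  by (rule ess_boundedI(1)[where c = "\<bar>c\<bar>"]) auto

lemma ess_bounded_linfty_compose:
  assumes [measurable]: "i \<in> leb01 \<rightarrow>\<^sub>M count_space UNIV"
  shows "ess_bounded (\<lambda>t. apply_bcontfun (a :: linfty) (i t))"
    "norm (abs_Linfty01 (\<lambda>t. apply_bcontfun a (i t))) \<le> norm a"
proof -
  have "(\<lambda>t. apply_bcontfun a (i t)) \<in> borel_measurable leb01"
    by (rule measurable_compose[OF assms]) simp
  then show "ess_bounded (\<lambda>t. apply_bcontfun a (i t))"
    "norm (abs_Linfty01 (\<lambda>t. apply_bcontfun a (i t))) \<le> norm a"
    by (auto intro!: ess_boundedI(1)[where c = "norm a"] norm_abs_Linfty01_le simp: abs_apply_linfty_le)
qed

definition pullback :: "(real \<Rightarrow> nat) \<Rightarrow> linfty \<Rightarrow> Linfty01" where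
  "pullback i a = abs_Linfty01 (\<lambda>t. apply_bcontfun a (i t))"

lemma pullback:
  assumes "i \<in> leb01 \<rightarrow>\<^sub>M count_space UNIV"
  shows linear_pullback: "linear (pullback i)" and norm_pullback: "norm (pullback i a) \<le> norm a"
  using ess_bounded_linfty_compose[OF assms]
  by (auto intro!: linearI simp: pullback_def plus_abs_Linfty01 scaleR_abs_Linfty01
      plus_bcontfun.rep_eq scaleR_bcontfun.rep_eq)

text \<open>Entry n is the average of y over the nth dyadic piece: rescaling the piece to unit
  length absorbs the division by its measure.\<close>

definition dyadic_means :: "Linfty01 \<Rightarrow> linfty" where
  "dyadic_means y = Bcontfun (\<lambda>n. integral_over {0..1} (Linfty01_coord n y))"

lemma contractive_retract_linfty: "contractive_retract (pullback dyadic_index) dyadic_means"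
proof -
  interpret L: countable_sup_power Linfty01_coord by (rule countable_sup_power_Linfty01)
  have m1: "measure leb01 {0..1} = 1" by (simp add: measure_leb01)
  have bd: "\<bar>integral_over {0..1} (Linfty01_coord n y)\<bar> \<le> norm y" for n y
    using abs_integral_over_le[of "{0..1}" "Linfty01_coord n y"] L.norm_coord[of n y] m1 by simp
  have app: "apply_bcontfun (dyadic_means y) n = integral_over {0..1} (Linfty01_coord n y)" for n y
    unfolding dyadic_means_def by (rule apply_Bcontfun_bounded[OF bd])
  note lin = linear_integral_over[OF atLeastAtMost_01_in_sets]
  show ?thesis
  proof
    fix y y' :: Linfty01 and a b :: linfty and r :: real
    show "pullback dyadic_index (a + b) = pullback dyadic_index a + pullback dyadic_index b"
      "pullback dyadic_index (r *\<^sub>R a) = r *\<^sub>R pullback dyadic_index a"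
      using linear_pullback[OF dyadic_index_measurable] by (auto simp: linear_add linear_scale)
    show "norm (pullback dyadic_index a) \<le> norm a"
      by (rule norm_pullback[OF dyadic_index_measurable])
    show "dyadic_means (y + y') = dyadic_means y + dyadic_means y'"
      "dyadic_means (r *\<^sub>R y) = r *\<^sub>R dyadic_means y"
      by (rule bcontfun_eqI;
          simp add: app plus_bcontfun.rep_eq scaleR_bcontfun.rep_eq L.coord_simps linear_add[OF lin] linear_scale[OF lin])+
    show "norm (dyadic_means y) \<le> norm y"
      by (rule norm_linfty_le) (simp add: app bd)
    show "dyadic_means (pullback dyadic_index a) = a"
    proof (rule bcontfun_eqI)
      fix n
      let ?f = "\<lambda>t. apply_bcontfun a (dyadic_index t)"
      have f: "ess_bounded ?f" by (rule ess_bounded_linfty_compose) (rule dyadic_index_measurable)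
      have "Linfty01_coord n (pullback dyadic_index a) = abs_Linfty01 (\<lambda>t. apply_bcontfun a n)"
        unfolding pullback_def Linfty01_coord_abs[OF f]
      proof (rule abs_Linfty01_eqI[OF ess_bounded_dyadic[OF f] ess_bounded_const])
        show "AE t in leb01. ?f (dyadic_map n t) = apply_bcontfun a n"
          using AE_leb01_pos by eventually_elim (simp add: dyadic_index_eq)
      qed
      then have "apply_bcontfun (dyadic_means (pullback dyadic_index a)) n
          = (LINT t|leb01. indicator {0..1} t * apply_bcontfun a n)"
        unfolding app by (simp only:) (intro integral_over_abs ess_bounded_const atLeastAtMost_01_in_sets)
      also have "\<dots> = (LINT t|leb01. apply_bcontfun a n * indicator {0..1} t)"
        by (simp only: mult.commute)
      also have "\<dots> = apply_bcontfun a n"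
        by (simp only: LINT_indicator_leb01[OF atLeastAtMost_01_in_sets] m1 mult_1_right)
      finally show "apply_bcontfun (dyadic_means (pullback dyadic_index a)) n = apply_bcontfun a n" .
    qed
  qed
qed

section \<open>Averages over uniform grids\<close>

text \<open>Grid k has k + 1 half-open cells of equal length, numbered 0 to k. The point t = 1 alone
  has number k + 1, and within [0,1] larger numbers give empty cells.\<close>

definition cell :: "nat \<Rightarrow> real \<Rightarrow> nat" where
  "cell k t = nat \<lfloor>real (Suc k) * t\<rfloor>"

definition cell_set :: "nat \<Rightarrow> nat \<Rightarrow> real set" where
  "cell_set k j = {t \<in> {0..1}. cell k t = j}"

lemma cell_measurable [measurable]: "cell k \<in> leb01 \<rightarrow>\<^sub>M count_space UNIV"
proof -
  have "cell k \<in> lborel \<rightarrow>\<^sub>M count_space UNIV"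
    unfolding cell_def by measurable
  then show ?thesis
    by (intro measurable_restrict_space1 measurable_completion)
qed

lemma cell_mono: "s \<le> t \<Longrightarrow> cell k s \<le> cell k t"
  unfolding cell_def by (intro nat_mono floor_mono mult_left_mono) auto

lemma cell_set_in_sets [measurable, simp]: "cell_set k j \<in> sets leb01"
proof -
  have "{t \<in> space leb01. cell k t = j} \<in> sets leb01" by measurable
  then show ?thesis by (simp add: cell_set_def)
qed

lemma measure_cell_set: "measure leb01 (cell_set k j) \<le> 1 / real (Suc k)"
proof -
  have "cell_set k j \<subseteq> {real j / real (Suc k) .. (real j + 1) / real (Suc k)}"
  proof
    fix t assume "t \<in> cell_set k j"
    then have "0 \<le> t" "cell k t = j" by (auto simp: cell_set_def)
    then have "real j \<le> real (Suc k) * t" "real (Suc k) * t \<le> real j + 1"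
      unfolding cell_def by (auto simp del: of_nat_Suc)
    then show "t \<in> {real j / real (Suc k) .. (real j + 1) / real (Suc k)}"
      by (simp add: field_simps del: of_nat_Suc)
  qed
  moreover have "cell_set k j \<in> sets lebesgue"
    using cell_set_in_sets[of k j] by (auto simp: sets_restrict_space intro!: sets.Int)
  ultimately have "measure lebesgue (cell_set k j)
      \<le> measure lebesgue {real j / real (Suc k) .. (real j + 1) / real (Suc k)}"
    by (intro measure_mono_fmeasurable) auto
  then show ?thesis
    by (simp add: measure_leb01 diff_divide_distrib[symmetric] divide_right_mono del: of_nat_Suc)
qed

text \<open>A null cell gets mean \<open>0\<close>, by \<open>x / 0 = 0\<close>.\<close>

definition cell_mean :: "Linfty01 \<Rightarrow> nat \<Rightarrow> nat \<Rightarrow> real" where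
  "cell_mean y k j = integral_over (cell_set k j) y / measure leb01 (cell_set k j)"

lemma cell_mean_mult: "cell_mean y k j * measure leb01 (cell_set k j) = integral_over (cell_set k j) y"
  by (simp add: cell_mean_def integral_over_null)

lemma abs_cell_mean: "\<bar>cell_mean y k j\<bar> \<le> norm y"
  using abs_integral_over_le[of "cell_set k j" y]
  by (cases "measure leb01 (cell_set k j) = 0")
    (auto simp: cell_mean_def divide_le_eq zero_less_measure_iff less_le)

definition cell_means :: "Linfty01 \<Rightarrow> linfty" where
  "cell_means y = Bcontfun (\<lambda>m. case prod_decode m of (k, j) \<Rightarrow> cell_mean y k j)"

lemma apply_cell_means: "apply_bcontfun (cell_means y) (prod_encode (k, j)) = cell_mean y k j"
  unfolding cell_means_def
  by (subst apply_Bcontfun_bounded[where K = "norm y"]) (auto simp: abs_cell_mean split: prod.split)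

lemma linfty_eqI_prod_encode:
  "(\<And>k j. apply_bcontfun a (prod_encode (k, j)) = apply_bcontfun b (prod_encode (k, j))) \<Longrightarrow> a = b"
  for a b :: linfty
  by (rule bcontfun_eqI) (metis prod.collapse prod_decode_inverse)

lemma linear_cell_means: "linear cell_means"
  by (rule linearI; rule linfty_eqI_prod_encode)
    (simp_all add: apply_cell_means plus_bcontfun.rep_eq scaleR_bcontfun.rep_eq cell_mean_def
      linear_add[OF linear_integral_over] linear_scale[OF linear_integral_over] add_divide_distrib)

lemma norm_cell_means: "norm (cell_means y) \<le> norm y"
proof (rule norm_linfty_le)
  fix m
  obtain k j where "m = prod_encode (k, j)" by (metis prod.collapse prod_decode_inverse)
  then show "\<bar>apply_bcontfun (cell_means y) m\<bar> \<le> norm y"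
    by (simp add: apply_cell_means abs_cell_mean)
qed

text \<open>Only row k of the sequence is used, as the values on the cells of grid k. Applied to
  \<open>cell_means y\<close> it gives the conditional expectation of y on that grid.\<close>

definition grid_step :: "nat \<Rightarrow> linfty \<Rightarrow> Linfty01" where
  "grid_step k = pullback (\<lambda>t. prod_encode (k, cell k t))"

lemma grid_index_measurable: "(\<lambda>t. prod_encode (k, cell k t)) \<in> leb01 \<rightarrow>\<^sub>M count_space UNIV"
  by (rule measurable_compose[OF cell_measurable]) simp

lemma linear_grid_step: "linear (grid_step k)" and norm_grid_step: "norm (grid_step k a) \<le> norm a"
  unfolding grid_step_def using pullback[OF grid_index_measurable] by auto

lemma integral_over_cell_grid_step:
  "integral_over (cell_set k j) (grid_step k (cell_means y)) = integral_over (cell_set k j) y"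
proof -
  have "ess_bounded (\<lambda>t. apply_bcontfun (cell_means y) (prod_encode (k, cell k t)))"
    using grid_index_measurable by (rule ess_bounded_linfty_compose)
  then have "integral_over (cell_set k j) (grid_step k (cell_means y))
      = (LINT t|leb01. indicator (cell_set k j) t * cell_mean y k (cell k t))"
    unfolding grid_step_def pullback_def apply_cell_means[symmetric]
    by (rule integral_over_abs) simp
  also have "\<dots> = (LINT t|leb01. cell_mean y k j * indicator (cell_set k j) t)"
    by (rule Bochner_Integration.integral_cong) (auto simp: indicator_def cell_set_def)
  also have "\<dots> = integral_over (cell_set k j) y"
    by (simp only: LINT_indicator_leb01[OF cell_set_in_sets] cell_mean_mult)
  finally show ?thesis .
qed

text \<open>Averaging preserves integrals over whole cells, and an initial interval consists of
  whole cells and part of one more. That part has measure at most 1 / (k + 1), so each of the two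
  integrals over it is at most norm y / (k + 1).\<close>

lemma integral_over_grid_step_tendsto:
  assumes s: "s \<in> {0..1}"
  shows "(\<lambda>k. integral_over {0..s} (grid_step k (cell_means y))) \<longlonglongrightarrow> integral_over {0..s} y"
proof -
  have bound: "\<bar>integral_over {0..s} (grid_step k (cell_means y)) - integral_over {0..s} y\<bar>
      \<le> 2 * norm y * (1 / real (Suc k))" for k
  proof -
    define x where "x = grid_step k (cell_means y)"
    \<comment> \<open>The union of the cells before cell j; with j the cell of s, it lies inside
      [0,s] by monotonicity of \<open>cell\<close>.\<close>
    define B where "B j = {t \<in> {0..1}. cell k t < j}" for j
    have B [simp]: "B j \<in> sets leb01" for j
    proof -
      have "{t \<in> space leb01. cell k t < j} \<in> sets leb01" by measurable
      then show ?thesis by (simp add: B_def)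
    qed
    have eqB: "integral_over (B j) x = integral_over (B j) y" for j
    proof (induction j)
      case 0
      then show ?case by (simp add: B_def integral_over_empty)
    next
      case (Suc j)
      have "B (Suc j) = B j \<union> cell_set k j" "B j \<inter> cell_set k j = {}"
        by (auto simp: B_def cell_set_def)
      then show ?case
        using Suc integral_over_cell_grid_step[of k j y] by (simp add: integral_over_Un x_def)
    qed
    define j where "j = cell k s"
    have A: "{0..s} \<in> sets leb01" using s by (intro atLeastAtMost_in_sets_leb01) simp
    have sub: "B j \<subseteq> {0..s}" "{0..s} - B j \<subseteq> cell_set k j"
    proof -
      have "t \<le> s" if "cell k t < cell k s" for t
        using that cell_mono[of s t k] by linarith
      then show "B j \<subseteq> {0..s}" by (auto simp: B_def j_def)
      have "cell k t = cell k s" if "t \<le> s" "\<not> cell k t < cell k s" for t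
        using that cell_mono[of t s k] by linarith
      then show "{0..s} - B j \<subseteq> cell_set k j"
        using s by (auto simp: B_def j_def cell_set_def)
    qed
    have D: "{0..s} - B j \<in> sets leb01" using A by auto
    have m: "measure leb01 ({0..s} - B j) \<le> 1 / real (Suc k)"
      using leb01.finite_measure_mono[OF sub(2)] measure_cell_set[of k j] by (simp del: of_nat_Suc)
    have le: "\<bar>integral_over ({0..s} - B j) w\<bar> \<le> norm y * (1 / real (Suc k))" if "norm w \<le> norm y" for w
      using abs_integral_over_le[OF D, of w] mult_mono[OF that m] by (simp del: of_nat_Suc)
    have "norm x \<le> norm y"
      unfolding x_def using norm_grid_step norm_cell_means order_trans by blast
    then have "\<bar>integral_over ({0..s} - B j) x - integral_over ({0..s} - B j) y\<bar> \<le> 2 * norm y * (1 / real (Suc k))"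
      using le[of x] le[of y] by linarith
    then show ?thesis
      using A sub(1) by (simp add: integral_over_Diff eqB x_def[symmetric] del: of_nat_Suc)
  qed
  have "(\<lambda>k. 2 * norm y * (1 / real (Suc k))) \<longlonglongrightarrow> 2 * norm y * 0"
    by (intro tendsto_intros LIMSEQ_Suc lim_1_over_n)
  then have lim: "(\<lambda>k. 2 * norm y * (1 / real (Suc k))) \<longlonglongrightarrow> 0"
    by (simp only: mult_zero_right)
  have "(\<lambda>k. integral_over {0..s} (grid_step k (cell_means y)) - integral_over {0..s} y) \<longlonglongrightarrow> 0"
    by (rule Lim_null_comparison[OF always_eventually lim]) (simp only: real_norm_def bound simp_thms)
  then show ?thesis by (rule LIM_zero_cancel)
qed

text \<open>The retraction sends a to a weak* generalised limit of its step functions: for each A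
  the integrals over A form a bounded sequence in k, and their values under L are the integrals of
  one element \<open>p a\<close>.\<close>

lemma ex_contractive_retract_Linfty01:
  obtains p where "contractive_retract cell_means p"
proof -
  obtain L :: "linfty \<Rightarrow> real" where L: "linear L" "\<And>a. \<bar>L a\<bar> \<le> norm a"
    "\<And>a l. apply_bcontfun a \<longlonglongrightarrow> l \<Longrightarrow> L a = l"
    using ex_generalised_limit by blast
  define ints where "ints A a = (Bcontfun (\<lambda>k. integral_over A (grid_step k a)) :: linfty)" for A a
  have bd: "\<bar>integral_over A (grid_step k a)\<bar> \<le> norm a * measure leb01 A" if "A \<in> sets leb01" for A k a
    using abs_integral_over_le[OF that, of "grid_step k a"] norm_grid_step[of k a]
    by (meson measure_nonneg mult_right_mono order_trans)
  have app: "apply_bcontfun (ints A a) k = integral_over A (grid_step k a)" if "A \<in> sets leb01" for A a k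
    unfolding ints_def by (rule apply_Bcontfun_bounded[OF bd[OF that]])
  have "\<exists>x. \<forall>A\<in>sets leb01. integral_over A x = L (ints A a)" for a
  proof (rule ex_Linfty01_density[of "\<lambda>A. L (ints A a)" "norm a"])
    fix A B assume AB: "A \<in> sets leb01" "B \<in> sets leb01" "A \<inter> B = {}"
    have "ints (A \<union> B) a = ints A a + ints B a"
      using AB by (intro bcontfun_eqI) (simp add: app plus_bcontfun.rep_eq integral_over_Un)
    then show "L (ints (A \<union> B) a) = L (ints A a) + L (ints B a)"
      by (simp add: linear_add[OF L(1)])
  next
    fix A assume A: "A \<in> sets leb01"
    have "norm (ints A a) \<le> norm a * measure leb01 A"
      by (rule norm_linfty_le) (simp add: app[OF A] bd[OF A])
    then show "\<bar>L (ints A a)\<bar> \<le> norm a * measure leb01 A"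
      using L(2)[of "ints A a"] by linarith
  qed blast
  \<comment> \<open>p comes from a bare choice; it is linear because integrals over sets determine
    an element and depend linearly on a.\<close>
  then obtain p where p: "\<And>A a. A \<in> sets leb01 \<Longrightarrow> integral_over A (p a) = L (ints A a)"
    by metis
  have "contractive_retract cell_means p"
  proof
    fix a b :: linfty and r :: real and y z :: Linfty01
    show "cell_means (y + z) = cell_means y + cell_means z" "cell_means (r *\<^sub>R y) = r *\<^sub>R cell_means y"
      using linear_cell_means by (auto simp: linear_add linear_scale)
    show "norm (cell_means y) \<le> norm y" by (rule norm_cell_means)
    show "p (a + b) = p a + p b"
    proof (rule Linfty01_eqI_integral_over)
      fix A assume A: "A \<in> sets leb01"
      have "ints A (a + b) = ints A a + ints A b"
        by (rule bcontfun_eqI) (simp add: app[OF A] plus_bcontfun.rep_eq linear_add[OF linear_grid_step]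
            linear_add[OF linear_integral_over[OF A]])
      then show "integral_over A (p (a + b)) = integral_over A (p a + p b)"
        by (simp add: p[OF A] linear_add[OF linear_integral_over[OF A]] linear_add[OF L(1)])
    qed
    show "p (r *\<^sub>R a) = r *\<^sub>R p a"
    proof (rule Linfty01_eqI_integral_over)
      fix A assume A: "A \<in> sets leb01"
      have "ints A (r *\<^sub>R a) = r *\<^sub>R ints A a"
        by (rule bcontfun_eqI) (simp add: app[OF A] scaleR_bcontfun.rep_eq linear_scale[OF linear_grid_step]
            linear_scale[OF linear_integral_over[OF A]])
      then show "integral_over A (p (r *\<^sub>R a)) = integral_over A (r *\<^sub>R p a)"
        by (simp add: p[OF A] linear_scale[OF linear_integral_over[OF A]] linear_scale[OF L(1)])
    qed
    show "norm (p a) \<le> norm a"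
    proof (rule norm_Linfty01_le_of_integral_over)
      fix A assume A: "A \<in> sets leb01"
      have "norm (ints A a) \<le> norm a * measure leb01 A"
        by (rule norm_linfty_le) (simp add: app[OF A] bd[OF A])
      then show "\<bar>integral_over A (p a)\<bar> \<le> norm a * measure leb01 A"
        using L(2)[of "ints A a"] by (simp add: p[OF A])
    qed
    \<comment> \<open>Over an initial interval the integrals converge to that of y, so L returns the
      ordinary limit; initial intervals suffice by \<open>Linfty01_eq_0I_intervals\<close>.\<close>
    have "p (cell_means y) - y = 0"
    proof (rule Linfty01_eq_0I_intervals)
      fix s :: real assume s: "s \<in> {0..1}"
      then have A: "{0..s} \<in> sets leb01" by (intro atLeastAtMost_in_sets_leb01) simp
      have "apply_bcontfun (ints {0..s} (cell_means y)) = (\<lambda>k. integral_over {0..s} (grid_step k (cell_means y)))"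
        by (rule ext) (rule app[OF A])
      then have "L (ints {0..s} (cell_means y)) = integral_over {0..s} y"
        using integral_over_grid_step_tendsto[OF s, of y] by (intro L(3)) (simp only:)
      then show "integral_over {0..s} (p (cell_means y) - y) = 0"
        by (simp add: linear_diff[OF linear_integral_over[OF A]] p[OF A])
    qed
    then show "p (cell_means y) = y" by simp
  qed
  then show thesis by (rule that)
qed

theorem corollary5p2:
  shows "banach_mazur_dist TYPE(linfty) TYPE(Linfty01) \<le> ereal ((3 + sqrt 2)\<^sup>2) \<and>
    (3 + sqrt 2)\<^sup>2 < (19.49 :: real)"
proof
  obtain p where "contractive_retract cell_means p"
    by (rule ex_contractive_retract_Linfty01)
  then show "banach_mazur_dist TYPE(linfty) TYPE(Linfty01) \<le> ereal ((3 + sqrt 2)\<^sup>2)"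
    using countable_sup_power_linfty countable_sup_power_Linfty01 contractive_retract_linfty
    by (intro banach_mazur_dist_mutual_retracts[of linfty_coord cell_means p
          Linfty01_coord "pullback dyadic_index" dyadic_means] power_retract.intro)
  \<comment> \<open>Precise enough for the last claim: 11 + 6 * 1.4143 = 19.4858.\<close>
  have "sqrt 2 < 1.4143"
    by (rule real_less_lsqrt) (auto simp: power2_eq_square)
  moreover have "(3 + sqrt 2)\<^sup>2 = 11 + 6 * sqrt 2"
    by (simp add: power2_sum)
  ultimately show "(3 + sqrt 2)\<^sup>2 < (19.49 :: real)" by simp
qed

end
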